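(* Let $p$ be a polynomial which is completely non-vanishing on $\mathbb{R}^n_+$ and let $\phi\in\mathcal S(\mathbb{R}^n_{\geq0})$. Write $\Delta_p+\mathbb{R}^n_+=\bigcap_{k=1}^N\{\boldsymbol\sigma\in\mathbb{R}^n:\langle\boldsymbol\mu_k,\boldsymbol\sigma\rangle\geq\nu_k\}$, where $N$ is the number of facets, the $\nu_k$ are integers and the $\boldsymbol\mu_k\in\mathbb{Z}^n_{\geq0}$ are the vectors in the inward normal direction of the facets of $\Delta_p+\mathbb{R}^n_+$ with mutually coprime coordinates. Then the Mellin transform $$\mathcal M_{\phi/p}(\boldsymbol s)=\int_{\mathbb{R}^n_+}\frac{\boldsymbol\epsilon^{\boldsymbol s}\,\phi(\boldsymbol\epsilon)}{p(\boldsymbol\epsilon)}\frac{d\boldsymbol\epsilon}{\boldsymbol\epsilon}$$ admits a meromorphic continuation to $\mathbb{C}^n$ of the form $$\mathcal M_{\phi/p}(\boldsymbol s)=\Phi(\boldsymbol s)\prod_{k=1}^N\Gamma(\langle\boldsymbol\mu_k,\boldsymbol s\rangle-\nu_k),$$ where $\Phi$ is an entire function.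
   Context: $\mathbb{R}^n_+=(0,\infty)^n$; $\frac{d\boldsymbol\epsilon}{\boldsymbol\epsilon}=\prod_i\frac{d\epsilon_i}{\epsilon_i}$. $\mathcal S(\mathbb{R}^n_{\geq0})$ is the space of smooth functions $\psi$ on $[0,\infty)^n$ with $\boldsymbol\epsilon^{\boldsymbol\alpha}\partial^{\boldsymbol\beta}\psi(\boldsymbol\epsilon)\to0$ as $\boldsymbol\epsilon\to\infty$ for all $\boldsymbol\alpha,\boldsymbol\beta\in\mathbb{Z}^n_{\geq0}$. For $p(\boldsymbol\epsilon)=\sum_{\alpha\in\mathcal A}a_\alpha\boldsymbol\epsilon^\alpha$ ($\mathcal A$ finite, $a_\alpha\neq0$), $\Delta_p$ is the convex hull of $\mathcal A$ (Newton polytope); for a face $\Gamma$ of $\Delta_p$, $p_\Gamma$ is the sum of monomials of $p$ with exponents in $\Gamma$; $p$ is completely non-vanishing on $\mathcal O$ if neither $p$ nor any $p_\Gamma$ vanishes on $\mathcal O$. $\Gamma$ in the product is Euler's Gamma function. *)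

theory Defs
  imports "HOL-Analysis.Analysis" "HOL-Library.Poly_Mapping" "HOL-Library.Set_Algebras"
begin

text \<open>
  A polynomial in variables indexed by \<open>'n\<close> with complex coefficients is a finitely supported map
  from exponent vectors to coefficients; its support \<open>Poly_Mapping.keys p\<close> is the set of exponents
  with nonzero coefficient.
\<close>

type_synonym 'n cpoly = "(nat ^ 'n) \<Rightarrow>\<^sub>0 complex"

definition to_real_vec :: "nat ^ 'n \<Rightarrow> real ^ 'n"
  where "to_real_vec \<alpha> = (\<chi> i. real (\<alpha> $ i))"

definition Re_vec :: "complex ^ 'n \<Rightarrow> real ^ 'n"
  where "Re_vec s = (\<chi> i. Re (s $ i))"

definition pos_orthant :: "(real ^ 'n) set"
  where "pos_orthant = {x. \<forall>i. 0 < x $ i}"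

definition nonneg_orthant :: "(real ^ 'n) set"
  where "nonneg_orthant = {x. \<forall>i. 0 \<le> x $ i}"

definition monom_at :: "nat ^ 'n::finite \<Rightarrow> real ^ 'n \<Rightarrow> real"
  where "monom_at \<alpha> x = (\<Prod>i\<in>UNIV. (x $ i) ^ (\<alpha> $ i))"

definition poly_at :: "'n::finite cpoly \<Rightarrow> real ^ 'n \<Rightarrow> complex"
  where "poly_at p x =
    (\<Sum>\<alpha>\<in>Poly_Mapping.keys p. Poly_Mapping.lookup p \<alpha> * complex_of_real (monom_at \<alpha> x))"

definition newton_polytope :: "'n::finite cpoly \<Rightarrow> (real ^ 'n) set"
  where "newton_polytope p = convex hull (to_real_vec ` Poly_Mapping.keys p)"

definition truncation :: "'n cpoly \<Rightarrow> (real ^ 'n) set \<Rightarrow> 'n cpoly"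
  where "truncation p \<Gamma> =
    (\<Sum>\<alpha> | \<alpha> \<in> Poly_Mapping.keys p \<and> to_real_vec \<alpha> \<in> \<Gamma>.
       Poly_Mapping.single \<alpha> (Poly_Mapping.lookup p \<alpha>))"

text \<open>
  The empty set is a face in the sense of \<^const>\<open>face_of\<close>; its truncation is the zero polynomial,
  so it has to be excluded.
\<close>

definition completely_nonvanishing_on :: "'n::finite cpoly \<Rightarrow> (real ^ 'n) set \<Rightarrow> bool"
  where "completely_nonvanishing_on p X \<longleftrightarrow>
    (\<forall>x\<in>X. poly_at p x \<noteq> 0) \<and>
    (\<forall>\<Gamma>. \<Gamma> face_of newton_polytope p \<and> \<Gamma> \<noteq> {} \<longrightarrow>
       (\<forall>x\<in>X. poly_at (truncation p \<Gamma>) x \<noteq> 0))"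

text \<open>
  \<open>partial_derivs_on S f D\<close>: \<open>f\<close> is infinitely differentiable on \<open>S\<close> and \<open>D \<beta>\<close> is its partial derivative
  of multi-index \<open>\<beta>\<close>. Derivatives are taken within \<open>S\<close>, hence are one-sided at boundary points of
  the orthant; there they are unique, so \<open>D\<close> is determined on the orthant by \<open>f\<close>.
\<close>

definition partial_derivs_on ::
    "(real ^ 'n::finite) set \<Rightarrow> (real ^ 'n \<Rightarrow> complex) \<Rightarrow> (nat ^ 'n \<Rightarrow> real ^ 'n \<Rightarrow> complex) \<Rightarrow> bool"
  where "partial_derivs_on S f D \<longleftrightarrow>
    (\<forall>x\<in>S. D 0 x = f x) \<and>
    (\<forall>\<beta>. \<forall>x\<in>S. (D \<beta> has_derivative
        (\<lambda>h. \<Sum>i\<in>UNIV. complex_of_real (h $ i) * D (\<beta> + axis i 1) x)) (at x within S))"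

definition schwartz_nonneg_orthant :: "(real ^ 'n::finite \<Rightarrow> complex) set"
  where "schwartz_nonneg_orthant = {\<psi>. \<exists>D. partial_derivs_on nonneg_orthant \<psi> D \<and>
    (\<forall>\<alpha> \<beta>. ((\<lambda>x. complex_of_real (monom_at \<alpha> x) * D \<beta> x) \<longlongrightarrow> 0)
       (inf at_infinity (principal nonneg_orthant)))}"

text \<open>
  The integrand is taken with respect to Lebesgue measure, so the factor \<open>1 / (\<epsilon>\<^sub>1 \<cdots> \<epsilon>\<^sub>n)\<close> of the
  measure \<open>d\<epsilon> / \<epsilon>\<close> is part of it.
\<close>

definition mellin_integrand :: "(real ^ 'n::finite \<Rightarrow> complex) \<Rightarrow> complex ^ 'n \<Rightarrow> real ^ 'n \<Rightarrow> complex"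
  where "mellin_integrand f s x =
    (\<Prod>i\<in>UNIV. complex_of_real (x $ i) powr (s $ i)) * f x *
    (\<Prod>i\<in>UNIV. 1 / complex_of_real (x $ i))"

definition mellin_converges :: "(real ^ 'n::finite \<Rightarrow> complex) \<Rightarrow> complex ^ 'n \<Rightarrow> bool"
  where "mellin_converges f s \<longleftrightarrow> set_integrable lborel pos_orthant (mellin_integrand f s)"

definition mellin :: "(real ^ 'n::finite \<Rightarrow> complex) \<Rightarrow> complex ^ 'n \<Rightarrow> complex"
  where "mellin f s = set_lebesgue_integral lborel pos_orthant (mellin_integrand f s)"

text \<open>Holomorphy in several variables: complex Frechet differentiability on an open set.\<close>

definition holomorphic_Cn_on :: "(complex ^ 'n::finite \<Rightarrow> complex) \<Rightarrow> (complex ^ 'n) set \<Rightarrow> bool"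
  where "holomorphic_Cn_on f U \<longleftrightarrow>
    (\<forall>s\<in>U. \<exists>c :: complex ^ 'n. (f has_derivative (\<lambda>h. \<Sum>i\<in>UNIV. c $ i * h $ i)) (at s))"

definition entire_Cn :: "(complex ^ 'n::finite \<Rightarrow> complex) \<Rightarrow> bool"
  where "entire_Cn f \<longleftrightarrow> holomorphic_Cn_on f UNIV"

text \<open>
  A meromorphic function is locally a quotient of holomorphic functions whose denominator is not
  identically zero; its values on the zero set of the local denominator are irrelevant.
\<close>

definition meromorphic_Cn :: "(complex ^ 'n::finite \<Rightarrow> complex) \<Rightarrow> bool"
  where "meromorphic_Cn f \<longleftrightarrow>
    (\<forall>z. \<exists>U g h. open U \<and> connected U \<and> z \<in> U \<and>
       holomorphic_Cn_on g U \<and> holomorphic_Cn_on h U \<and> (\<exists>w\<in>U. h w \<noteq> 0) \<and>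
       (\<forall>w\<in>U. h w \<noteq> 0 \<longrightarrow> f w = g w / h w))"

definition pairing :: "nat ^ 'n::finite \<Rightarrow> complex ^ 'n \<Rightarrow> complex"
  where "pairing \<mu> s = (\<Sum>i\<in>UNIV. of_nat (\<mu> $ i) * s $ i)"

text \<open>
  The polyhedron \<open>\<Delta>\<^sub>p + \<real>\<^sup>n\<^sub>\<ge>\<^sub>0\<close>. The closed orthant is used so that it is an intersection of closed
  half-spaces; its interior is the Minkowski sum of the polytope with the open orthant.
\<close>

definition newton_polyhedron :: "'n::finite cpoly \<Rightarrow> (real ^ 'n) set"
  where "newton_polyhedron p = newton_polytope p + nonneg_orthant"

text \<open>
  The description of a full-dimensional polyhedron \<open>P\<close> by its facets: the \<open>N\<close> supporting
  hyperplanes \<open>\<langle>\<mu>\<^sub>k, \<sigma>\<rangle> = \<nu>\<^sub>k\<close> cut out the facets of \<open>P\<close>, each exactly once. Coordinates of \<open>\<mu>\<^sub>k\<close> are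
  coprime as a tuple (not pairwise), which also forces \<open>\<mu>\<^sub>k\<close> to be nonzero.
\<close>

definition facet_presentation ::
    "(real ^ 'n::finite) set \<Rightarrow> nat \<Rightarrow> (nat \<Rightarrow> nat ^ 'n) \<Rightarrow> (nat \<Rightarrow> int) \<Rightarrow> bool"
  where "facet_presentation P N \<mu> \<nu> \<longleftrightarrow>
    P = (\<Inter>k\<in>{1..N}. {\<sigma>. to_real_vec (\<mu> k) \<bullet> \<sigma> \<ge> real_of_int (\<nu> k)}) \<and>
    bij_betw (\<lambda>k. P \<inter> {\<sigma>. to_real_vec (\<mu> k) \<bullet> \<sigma> = real_of_int (\<nu> k)}) {1..N} {F. F facet_of P} \<and>
    (\<forall>k\<in>{1..N}. Gcd (range (\<lambda>i. \<mu> k $ i)) = 1)"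

end

theory Submission
  imports Defs
begin

text \<open>
  In the coordinates \<open>x = exp t\<close> the Mellin transform is the integral over \<open>\<real>\<^sup>n\<close> of
  \<open>exp (s \<bullet> t) * \<phi> / p\<close>. Complete non-vanishing makes \<open>\<bar>p\<bar>\<close> comparable to the sum of its monomials, so
  the integral with \<open>p ^ m\<close> in the denominator converges when \<open>Re s\<close> lies in the interior of the
  \<open>m\<close>-fold dilate of the Newton polyhedron. Since \<open>\<langle>\<mu>\<^sub>j, \<alpha>\<rangle> = \<nu>\<^sub>j\<close> for the exponents \<open>\<alpha>\<close> of \<open>p\<close> on the
  facet \<open>j\<close>, integrating by parts along \<open>\<mu>\<^sub>j\<close> expresses \<open>\<langle>\<mu>\<^sub>j, s\<rangle> - \<nu>\<^sub>j\<close> times the integral by integrals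
  converging on the half-space shifted by one across that facet. After \<open>L\<close> rounds through all facets,
  \<open>\<Prod>\<^sub>k (z\<^sub>k)\<^sub>L\<close> times the transform, where \<open>z\<^sub>k = \<langle>\<mu>\<^sub>k, s\<rangle> - \<nu>\<^sub>k\<close>, is holomorphic for \<open>Re z\<^sub>k > - L\<close>; multiplying
  by the entire function \<open>\<Prod>\<^sub>k 1 / \<Gamma>(z\<^sub>k + L)\<close> gives a value of \<open>\<Phi>\<close> that does not depend on \<open>L\<close>.
\<close>

subsection \<open>Exponential sums\<close>

text \<open>Faces enter because the quotient of \<bar>p\<bar> by the sum of its monomials can
  degenerate only at infinity, where the truncation of p to some face governs it. A term of the
  continuation consists of a derivative index \<beta>, a power m + 1 of p and a shift a of s. Its
  depth across facet k is the integer \<langle>\<mu>_k, a\<rangle> - m * \<nu>_k: the shifted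
  integral converges for Re z_k > - depth. Differentiating 1 / p raises m, but it also brings down a
  monomial of p, and \<langle>\<mu>_k, \<alpha>\<rangle> \<ge> \<nu>_k for its exponent \<alpha>, so
  no depth ever decreases. One Gamma factor per facet suffices because a term of depth l across
  facet j produces the linear factor z_j + l whatever \<beta>, m and a are. A whole sum of terms is
  therefore pushed across the facet by a single multiplication, and regions where several facets
  meet cost only the product of their separate factors.\<close>

lemma finite_family_convergent_subsequence:
  fixes w :: "'i \<Rightarrow> nat \<Rightarrow> real"
  assumes "finite A" and "\<And>\<alpha> j. \<alpha> \<in> A \<Longrightarrow> w \<alpha> j \<in> {0..1}"
  shows "\<exists>r l. strict_mono r \<and> (\<forall>\<alpha>\<in>A. (\<lambda>j. w \<alpha> (r j)) \<longlonglongrightarrow> l \<alpha>)"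
  using assms
proof (induction A rule: finite_induct)
  case empty
  show ?case by (intro exI[of _ id]) (auto simp: strict_mono_def)
next
  case (insert b A)
  then obtain r l where r: "strict_mono r" and l: "\<And>\<alpha>. \<alpha> \<in> A \<Longrightarrow> (\<lambda>j. w \<alpha> (r j)) \<longlonglongrightarrow> l \<alpha>"
    by (metis insertCI)
  have "seq_compact {0..1::real}" by (simp add: compact_imp_seq_compact)
  moreover have "\<forall>j. w b (r j) \<in> {0..1}" using insert.prems by blast
  ultimately obtain lb q where q: "strict_mono q" "((\<lambda>j. w b (r j)) \<circ> q) \<longlonglongrightarrow> lb"
    unfolding seq_compact_def by meson
  have "(\<lambda>j. w \<alpha> ((r \<circ> q) j)) \<longlonglongrightarrow> (l(b := lb)) \<alpha>" if "\<alpha> \<in> insert b A" for \<alpha>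
  proof (cases "\<alpha> = b")
    case True
    then show ?thesis using q(2) by (simp add: o_def)
  next
    case False
    then show ?thesis
      using that LIMSEQ_subseq_LIMSEQ[OF l q(1)] by (auto simp: o_def)
  qed
  moreover have "strict_mono (r \<circ> q)" using r q(1) by (rule strict_mono_o)
  ultimately show ?case by blast
qed

text \<open>The range of a linear map in finite dimension is closed, so the limits are again
  attained although \<open>T\<close> itself may diverge. As the index type is no vector space, the
  argument runs through the normal operator \<open>Q\<close> on the space of the
  \<open>v \<alpha>\<close>.\<close>

lemma limit_of_consistent_linear_systems:
  fixes v :: "'i \<Rightarrow> 'b::euclidean_space" and T :: "nat \<Rightarrow> 'b"
  assumes "finite B" and lim: "\<And>\<alpha>. \<alpha> \<in> B \<Longrightarrow> (\<lambda>j. v \<alpha> \<bullet> T j) \<longlonglongrightarrow> l \<alpha>"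
  shows "\<exists>y. \<forall>\<alpha>\<in>B. v \<alpha> \<bullet> y = l \<alpha>"
proof -
  define Q where "Q t = (\<Sum>\<alpha>\<in>B. (v \<alpha> \<bullet> t) *\<^sub>R v \<alpha>)" for t
  have "linear Q"
    unfolding Q_def
    by (intro linearI) (simp_all add: inner_add_right scaleR_add_left sum.distrib scaleR_sum_right)
  then have "closed (range Q)"
    by (intro closed_subspace linear_subspace_image) (auto simp: subspace_UNIV)
  moreover have "Q (T j) \<in> range Q" for j by simp
  moreover have "(\<lambda>j. Q (T j)) \<longlonglongrightarrow> (\<Sum>\<alpha>\<in>B. l \<alpha> *\<^sub>R v \<alpha>)"
    unfolding Q_def by (intro tendsto_sum tendsto_scaleR lim tendsto_const)
  ultimately have "(\<Sum>\<alpha>\<in>B. l \<alpha> *\<^sub>R v \<alpha>) \<in> range Q"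
    by (rule closed_sequentially)
  then obtain y where y: "(\<Sum>\<alpha>\<in>B. l \<alpha> *\<^sub>R v \<alpha>) = Q y" by auto
  define r where "r \<alpha> = l \<alpha> - v \<alpha> \<bullet> y" for \<alpha>
  have r0: "(\<Sum>\<alpha>\<in>B. r \<alpha> *\<^sub>R v \<alpha>) = 0"
    using y by (simp add: r_def Q_def scaleR_diff_left sum_subtractf)
  \<comment> \<open>The residual \<open>r\<close> is a linear relation among the
    \<open>v \<alpha>\<close>, so it kills the values at each \<open>T j - y\<close>; in the limit
    this makes it orthogonal to itself.\<close>
  have "(\<lambda>j. \<Sum>\<alpha>\<in>B. r \<alpha> * (v \<alpha> \<bullet> T j - v \<alpha> \<bullet> y)) \<longlonglongrightarrow> (\<Sum>\<alpha>\<in>B. r \<alpha> * (l \<alpha> - v \<alpha> \<bullet> y))"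
    by (intro tendsto_sum tendsto_mult tendsto_const tendsto_diff lim)
  moreover have "(\<Sum>\<alpha>\<in>B. r \<alpha> * (v \<alpha> \<bullet> T j - v \<alpha> \<bullet> y)) = 0" for j
  proof -
    have "(\<Sum>\<alpha>\<in>B. r \<alpha> * (v \<alpha> \<bullet> T j - v \<alpha> \<bullet> y)) = (\<Sum>\<alpha>\<in>B. r \<alpha> *\<^sub>R v \<alpha>) \<bullet> (T j - y)"
      by (simp add: inner_sum_left inner_diff_right right_diff_distrib sum_subtractf)
    then show ?thesis by (simp add: r0)
  qed
  ultimately have "(\<Sum>\<alpha>\<in>B. r \<alpha> * r \<alpha>) = 0"
    unfolding r_def by (simp add: LIMSEQ_const_iff)
  then have "\<forall>\<alpha>\<in>B. r \<alpha> = 0"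
    using \<open>finite B\<close> by (subst (asm) sum_nonneg_eq_0_iff) auto
  then show ?thesis by (auto simp: r_def)
qed

lemma inner_le_ln_exp_sum:
  fixes A :: "'a::euclidean_space set"
  assumes "finite A" and "z \<in> convex hull A"
  shows "z \<bullet> t \<le> ln (\<Sum>\<alpha>\<in>A. exp (\<alpha> \<bullet> t))"
proof -
  let ?S = "\<Sum>\<alpha>\<in>A. exp (\<alpha> \<bullet> t)"
  have "A \<noteq> {}" using assms(2) by auto
  then have "?S > 0" using \<open>finite A\<close> by (intro sum_pos) auto
  have "A \<subseteq> {z. t \<bullet> z \<le> ln ?S}"
  proof
    fix \<alpha> assume "\<alpha> \<in> A"
    then have "exp (\<alpha> \<bullet> t) \<le> ?S"
      using \<open>finite A\<close> by (intro member_le_sum) auto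
    then show "\<alpha> \<in> {z. t \<bullet> z \<le> ln ?S}"
      using \<open>?S > 0\<close> by (simp add: ln_ge_iff inner_commute)
  qed
  then have "convex hull A \<subseteq> {z. t \<bullet> z \<le> ln ?S}"
    by (intro hull_minimal convex_halfspace_le)
  then show ?thesis using assms(2) by (auto simp: inner_commute)
qed

text \<open>Along points violating every bound, the normalised monomials \<open>w\<close> stay in
  [0, 1] and sum to 1, so they converge on a subsequence even if the points escape. The limits are
  supported on one face and are, up to a common factor, the monomials at some point
  \<open>y\<close>; there the sum over that face would vanish.\<close>

lemma exp_sum_lower_bound:
  fixes A :: "'a::euclidean_space set" and a :: "'a \<Rightarrow> complex"
  assumes "finite A" and "A \<noteq> {}"
    and nonvan: "\<And>\<Gamma> y. \<Gamma> face_of convex hull A \<Longrightarrow> \<Gamma> \<noteq> {} \<Longrightarrow>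
      (\<Sum>\<alpha>\<in>A \<inter> \<Gamma>. a \<alpha> * of_real (exp (\<alpha> \<bullet> y))) \<noteq> 0"
  shows "\<exists>c>0. \<forall>t. c * (\<Sum>\<alpha>\<in>A. exp (\<alpha> \<bullet> t)) \<le> norm (\<Sum>\<alpha>\<in>A. a \<alpha> * of_real (exp (\<alpha> \<bullet> t)))"
proof (rule ccontr)
  define S where "S t = (\<Sum>\<alpha>\<in>A. exp (\<alpha> \<bullet> t))" for t
  define P where "P t = (\<Sum>\<alpha>\<in>A. a \<alpha> * of_real (exp (\<alpha> \<bullet> t)))" for t
  have Spos: "S t > 0" for t
    unfolding S_def using assms(1,2) by (intro sum_pos) auto
  assume "\<not> ?thesis"
  then have "\<forall>c>0. \<exists>t. norm (P t) < c * S t"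
    unfolding S_def P_def by (meson not_le)
  then have "\<forall>j. \<exists>t. norm (P t) < inverse (real (Suc j)) * S t"
    by (metis inverse_positive_iff_positive of_nat_0_less_iff zero_less_Suc)
  then obtain T0 where T0: "\<And>j. norm (P (T0 j)) < inverse (real (Suc j)) * S (T0 j)"
    by metis
  define w where "w \<alpha> t = exp (\<alpha> \<bullet> t) / S t" for \<alpha> t
  have w01: "w \<alpha> t \<in> {0..1}" if "\<alpha> \<in> A" for \<alpha> t
  proof -
    have "exp (\<alpha> \<bullet> t) \<le> S t"
      unfolding S_def using assms(1) that by (intro member_le_sum) auto
    then show ?thesis using Spos[of t] by (simp add: w_def)
  qed
  have ln_w: "ln (w \<alpha> t) = \<alpha> \<bullet> t - ln (S t)" for \<alpha> t
    using Spos[of t] by (simp add: w_def ln_div)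
  have wpos: "w \<alpha> t > 0" for \<alpha> t using Spos[of t] by (simp add: w_def)
  obtain r l where r: "strict_mono r" and l: "\<And>\<alpha>. \<alpha> \<in> A \<Longrightarrow> (\<lambda>j. w \<alpha> (T0 (r j))) \<longlonglongrightarrow> l \<alpha>"
    using finite_family_convergent_subsequence[of A "\<lambda>\<alpha> j. w \<alpha> (T0 j)"] assms(1) w01 by blast
  define T where "T = T0 \<circ> r"
  have l: "\<And>\<alpha>. \<alpha> \<in> A \<Longrightarrow> (\<lambda>j. w \<alpha> (T j)) \<longlonglongrightarrow> l \<alpha>"
    using l by (simp add: T_def)
  have l_nonneg: "l \<alpha> \<ge> 0" if "\<alpha> \<in> A" for \<alpha>
    using l[OF that] by (rule LIMSEQ_le_const) (auto intro: less_imp_le wpos)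
  have sum_l: "(\<Sum>\<alpha>\<in>A. l \<alpha>) = 1"
  proof -
    have "(\<lambda>j. \<Sum>\<alpha>\<in>A. w \<alpha> (T j)) \<longlonglongrightarrow> (\<Sum>\<alpha>\<in>A. l \<alpha>)"
      by (intro tendsto_sum l)
    moreover have "(\<Sum>\<alpha>\<in>A. w \<alpha> t) = 1" for t
      using Spos[of t] by (simp add: w_def S_def flip: sum_divide_distrib)
    ultimately show ?thesis by (simp add: LIMSEQ_const_iff)
  qed
  have al: "(\<Sum>\<alpha>\<in>A. a \<alpha> * of_real (l \<alpha>)) = 0"
  proof -
    have "(\<lambda>j. \<Sum>\<alpha>\<in>A. a \<alpha> * of_real (w \<alpha> (T j))) \<longlonglongrightarrow> (\<Sum>\<alpha>\<in>A. a \<alpha> * of_real (l \<alpha>))"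
      by (intro tendsto_sum tendsto_mult tendsto_const tendsto_of_real l)
    moreover have "(\<lambda>j. \<Sum>\<alpha>\<in>A. a \<alpha> * of_real (w \<alpha> (T j))) \<longlonglongrightarrow> 0"
    proof (rule Lim_null_comparison)
      have "norm (\<Sum>\<alpha>\<in>A. a \<alpha> * of_real (w \<alpha> (T j))) \<le> inverse (real (Suc (r j)))" for j
      proof -
        have "(\<Sum>\<alpha>\<in>A. a \<alpha> * of_real (w \<alpha> (T j))) = P (T j) / of_real (S (T j))"
          by (simp add: P_def w_def sum_divide_distrib)
        then show ?thesis
          using T0[of "r j"] Spos[of "T j"]
          by (simp add: T_def norm_divide pos_divide_le_eq del: of_nat_Suc)
      qed
      then show "\<forall>\<^sub>F j in sequentially. norm (\<Sum>\<alpha>\<in>A. a \<alpha> * of_real (w \<alpha> (T j))) \<le> inverse (real (Suc (r j)))"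
        by simp
      show "(\<lambda>j. inverse (real (Suc (r j)))) \<longlonglongrightarrow> 0"
        using LIMSEQ_subseq_LIMSEQ[OF LIMSEQ_inverse_real_of_nat r] by (simp add: o_def)
    qed
    ultimately show ?thesis by (rule LIMSEQ_unique)
  qed
  \<comment> \<open>The quantity is never positive on the hull, so \<Gamma> collects the points
    where it stays bounded along the sequence. If a combination of two non-positive quantities with
    positive weights is bounded below, each of them is; this is the face property.\<close>
  define \<Gamma> where "\<Gamma> = {z \<in> convex hull A. \<exists>b. \<forall>j. b \<le> z \<bullet> T j - ln (S (T j))}"
  have up: "z \<bullet> t - ln (S t) \<le> 0" if "z \<in> convex hull A" for z t
    using inner_le_ln_exp_sum[OF assms(1) that, of t] by (simp add: S_def)
  have face: "\<Gamma> face_of convex hull A"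
    unfolding face_of_def
  proof (intro conjI ballI impI)
    show "\<Gamma> \<subseteq> convex hull A" by (auto simp: \<Gamma>_def)
    show "convex \<Gamma>"
      unfolding convex_def
    proof (intro ballI allI impI)
      fix x y and u v :: real
      assume *: "x \<in> \<Gamma>" "y \<in> \<Gamma>" "0 \<le> u" "0 \<le> v" "u + v = 1"
      then obtain bx bY where b: "\<And>j. bx \<le> x \<bullet> T j - ln (S (T j))" "\<And>j. bY \<le> y \<bullet> T j - ln (S (T j))"
        by (auto simp: \<Gamma>_def)
      have "u * bx + v * bY \<le> (u *\<^sub>R x + v *\<^sub>R y) \<bullet> T j - ln (S (T j))" for j
      proof -
        have "(u *\<^sub>R x + v *\<^sub>R y) \<bullet> T j - ln (S (T j)) =
          u * (x \<bullet> T j - ln (S (T j))) + v * (y \<bullet> T j - ln (S (T j))) - (1 - (u + v)) * ln (S (T j))"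
          by (simp add: inner_add_left algebra_simps)
        then show ?thesis
          using * b[of j] by (simp add: add_mono mult_left_mono)
      qed
      moreover have "u *\<^sub>R x + v *\<^sub>R y \<in> convex hull A"
        using * convexD[OF convex_convex_hull] by (auto simp: \<Gamma>_def)
      ultimately show "u *\<^sub>R x + v *\<^sub>R y \<in> \<Gamma>" by (auto simp: \<Gamma>_def)
    qed
    have half: "x \<in> \<Gamma>" if xy: "x \<in> convex hull A" "y \<in> convex hull A"
      and u: "0 < u" "u < 1" and z: "(1 - u) *\<^sub>R x + u *\<^sub>R y \<in> \<Gamma>" for x y and u :: real
    proof -
      obtain b where b: "\<And>j. b \<le> ((1 - u) *\<^sub>R x + u *\<^sub>R y) \<bullet> T j - ln (S (T j))"
        using z by (auto simp: \<Gamma>_def)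
      have "b / (1 - u) \<le> x \<bullet> T j - ln (S (T j))" for j
      proof -
        have "b \<le> (1 - u) * (x \<bullet> T j - ln (S (T j))) + u * (y \<bullet> T j - ln (S (T j)))"
          using b[of j] by (simp add: inner_add_left algebra_simps)
        also have "\<dots> \<le> (1 - u) * (x \<bullet> T j - ln (S (T j)))"
          using u(1) up[OF xy(2), of "T j"] by (simp add: mult_nonneg_nonpos)
        finally show ?thesis using u by (simp add: divide_le_eq mult.commute)
      qed
      then show ?thesis using xy by (auto simp: \<Gamma>_def)
    qed
    fix x y z
    assume xyz: "x \<in> convex hull A" "y \<in> convex hull A" "z \<in> \<Gamma>" "z \<in> open_segment x y"
    then obtain u where u: "0 < u" "u < 1" "z = (1 - u) *\<^sub>R x + u *\<^sub>R y"
      by (auto simp: in_segment)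
    show "x \<in> \<Gamma>" using half[of x y u] xyz u by auto
    show "y \<in> \<Gamma>" using half[of y x "1 - u"] xyz u by (auto simp: add.commute)
  qed
  have supp: "\<alpha> \<in> \<Gamma> \<longleftrightarrow> l \<alpha> > 0" if "\<alpha> \<in> A" for \<alpha>
  proof
    assume "\<alpha> \<in> \<Gamma>"
    then obtain b where "\<And>j. b \<le> ln (w \<alpha> (T j))" by (auto simp: \<Gamma>_def ln_w)
    then have "exp b \<le> w \<alpha> (T j)" for j using wpos by (simp add: ln_ge_iff)
    then have "exp b \<le> l \<alpha>" using l[OF that] by (intro LIMSEQ_le_const) auto
    then show "l \<alpha> > 0" using exp_gt_zero[of b] by linarith
  next
    assume "l \<alpha> > 0"
    then have "(\<lambda>j. ln (w \<alpha> (T j))) \<longlonglongrightarrow> ln (l \<alpha>)"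
      using l[OF that] by (intro tendsto_ln) auto
    then have "Bseq (\<lambda>j. ln (w \<alpha> (T j)))" by (simp add: convergent_imp_Bseq convergentI)
    then obtain K where "\<And>j. norm (ln (w \<alpha> (T j))) \<le> K" by (auto simp: Bseq_def)
    then have "\<forall>j. - K \<le> ln (w \<alpha> (T j))" by (auto simp: abs_le_iff minus_le_iff)
    then show "\<alpha> \<in> \<Gamma>" using that by (auto simp: \<Gamma>_def ln_w hull_inc)
  qed
  have "\<Gamma> \<noteq> {}"
  proof
    assume "\<Gamma> = {}"
    then have "\<forall>\<alpha>\<in>A. l \<alpha> = 0" using supp l_nonneg by force
    then show False using sum_l by simp
  qed
  \<comment> \<open>The extra coordinate 1 absorbs the normalisation \<open>- ln (S (T j))\<close>,
    which need not converge by itself; its counterpart for the limits is the constant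
    \<open>c\<close> below.\<close>
  have "\<exists>y. \<forall>\<alpha>\<in>A \<inter> \<Gamma>. (\<alpha>, 1::real) \<bullet> y = ln (l \<alpha>)"
  proof (rule limit_of_consistent_linear_systems)
    show "finite (A \<inter> \<Gamma>)" using assms(1) by simp
    fix \<alpha> assume "\<alpha> \<in> A \<inter> \<Gamma>"
    then have "(\<lambda>j. ln (w \<alpha> (T j))) \<longlonglongrightarrow> ln (l \<alpha>)"
      using l supp by (intro tendsto_ln) auto
    then show "(\<lambda>j. (\<alpha>, 1::real) \<bullet> (T j, - ln (S (T j)))) \<longlonglongrightarrow> ln (l \<alpha>)"
      by (simp add: ln_w)
  qed
  then obtain y c where y: "\<And>\<alpha>. \<alpha> \<in> A \<inter> \<Gamma> \<Longrightarrow> \<alpha> \<bullet> y + c = ln (l \<alpha>)" by auto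
  have "(\<Sum>\<alpha>\<in>A \<inter> \<Gamma>. a \<alpha> * of_real (exp (\<alpha> \<bullet> y))) = (\<Sum>\<alpha>\<in>A \<inter> \<Gamma>. a \<alpha> * of_real (l \<alpha>)) * of_real (exp (- c))"
    unfolding sum_distrib_right
  proof (rule sum.cong[OF refl])
    fix \<alpha> assume \<alpha>: "\<alpha> \<in> A \<inter> \<Gamma>"
    then have "l \<alpha> > 0" using supp[of \<alpha>] by simp
    then have "l \<alpha> = exp (\<alpha> \<bullet> y + c)" unfolding y[OF \<alpha>] by (rule exp_ln[symmetric])
    also have "\<dots> * exp (- c) = exp (\<alpha> \<bullet> y)" unfolding exp_add[symmetric] by simp
    finally have "exp (\<alpha> \<bullet> y) = l \<alpha> * exp (- c)" by (rule sym)
    then show "a \<alpha> * of_real (exp (\<alpha> \<bullet> y)) = a \<alpha> * of_real (l \<alpha>) * of_real (exp (- c))"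
      by simp
  qed
  also have "(\<Sum>\<alpha>\<in>A \<inter> \<Gamma>. a \<alpha> * of_real (l \<alpha>)) = (\<Sum>\<alpha>\<in>A. a \<alpha> * of_real (l \<alpha>))"
  proof (intro sum.mono_neutral_left ballI)
    fix \<alpha> assume "\<alpha> \<in> A - A \<inter> \<Gamma>"
    then have "l \<alpha> = 0" using supp[of \<alpha>] l_nonneg[of \<alpha>] by auto
    then show "a \<alpha> * of_real (l \<alpha>) = 0" by simp
  qed (use assms(1) in auto)
  finally show False using nonvan[OF face \<open>\<Gamma> \<noteq> {}\<close>] al by simp
qed

subsection \<open>Exponentially decaying functions\<close>

text \<open>The rate is existential so that part of it can be given up to absorb polynomial
  factors.\<close>

definition exp_decay :: "('a::real_normed_vector \<Rightarrow> 'b::real_normed_vector) \<Rightarrow> bool"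
  where "exp_decay f \<longleftrightarrow> (\<exists>C \<delta>. \<delta> > 0 \<and> (\<forall>t. norm (f t) \<le> C * exp (- \<delta> * norm t)))"

lemma integrable_exp_neg_abs:
  fixes a :: real
  assumes "a > 0"
  shows "integrable lborel (\<lambda>x::real. exp (- a * \<bar>x\<bar>))"
proof -
  have lim: "((\<lambda>x. - exp (- a * x) / a) \<longlongrightarrow> 0) at_top"
  proof -
    have "((\<lambda>x. exp (- (a * x))) \<longlongrightarrow> 0) at_top"
      by (intro filterlim_compose[OF exp_at_bot] filterlim_compose[OF filterlim_uminus_at_bot_at_top]
          filterlim_tendsto_pos_mult_at_top[OF tendsto_const assms] filterlim_ident)
    from tendsto_mult_right_zero[OF this, of "- 1 / a"] show ?thesis by simp
  qed
  have "(\<integral>\<^sup>+x. ennreal (exp (- a * x)) * indicator {0..} x \<partial>lborel) = ennreal (0 - - exp (- a * 0) / a)"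
    by (rule nn_integral_FTC_atLeast[OF _ _ _ lim]) (use assms in \<open>auto intro!: derivative_eq_intros\<close>)
  then have 1: "integrable lborel (\<lambda>x. exp (- a * x) * indicator {0..} x)"
    by (intro integrableI_bounded)
      (auto simp: ennreal_mult ennreal_indicator abs_mult intro: le_less_trans[OF eq_refl])
  then have 2: "integrable lborel (\<lambda>x. exp (- a * (0 + (- 1) * x)) * indicator {0..} (0 + (- 1) * x))"
    by (rule lborel_integrable_real_affine) simp
  show ?thesis
    by (rule Bochner_Integration.integrable_bound[OF Bochner_Integration.integrable_add[OF 1 2]])
      (auto simp: indicator_def)
qed

lemma integrable_exp_neg_norm:
  assumes "\<delta> > 0"
  shows "integrable lborel (\<lambda>t::'a::euclidean_space. exp (- \<delta> * norm t))"
proof (rule integrableI_bounded)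
  \<comment> \<open>The rate is split evenly over the coordinates: the l1 norm is at most
    \<open>DIM('a)\<close> times the norm, so the integrand is dominated by a product of
    one-dimensional exponentials.\<close>
  define a where "a = \<delta> / real DIM('a)"
  have "a > 0" using assms by (simp add: a_def)
  define I where "I = (\<integral>x. exp (- a * \<bar>x\<bar>) \<partial>lborel)"
  have le: "exp (- \<delta> * norm t) \<le> (\<Prod>b\<in>Basis. exp (- a * \<bar>t \<bullet> b\<bar>))" for t :: 'a
  proof -
    have "(\<Sum>b\<in>Basis. \<bar>t \<bullet> b\<bar>) \<le> (\<Sum>b\<in>(Basis::'a set). norm t)"
      by (intro sum_mono Basis_le_norm)
    then have "a * (\<Sum>b\<in>Basis. \<bar>t \<bullet> b\<bar>) \<le> a * (real DIM('a) * norm t)"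
      using \<open>a > 0\<close> by (intro mult_left_mono) auto
    moreover have "(\<Sum>b\<in>Basis. - a * \<bar>t \<bullet> b\<bar>) = - (a * (\<Sum>b\<in>Basis. \<bar>t \<bullet> b\<bar>))"
      by (simp add: sum_distrib_left sum_negf)
    ultimately show ?thesis
      by (simp add: a_def flip: exp_sum)
  qed
  have "(\<integral>\<^sup>+t. ennreal (norm (exp (- \<delta> * norm (t::'a)))) \<partial>lborel)
      \<le> (\<integral>\<^sup>+t. (\<Prod>b\<in>Basis. ennreal (exp (- a * \<bar>(t::'a) \<bullet> b\<bar>))) \<partial>lborel)"
    by (rule nn_integral_mono) (simp add: prod_ennreal ennreal_leI le[simplified])
  also have "\<dots> = (\<Prod>b\<in>(Basis::'a set). (\<integral>\<^sup>+x. ennreal (exp (- a * \<bar>x\<bar>)) \<partial>lborel))"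
    by (rule nn_integral_lborel_prod) auto
  also have "(\<integral>\<^sup>+x. ennreal (exp (- a * \<bar>x\<bar>)) \<partial>lborel) = ennreal I"
    unfolding I_def using integrable_exp_neg_abs[OF \<open>a > 0\<close>]
    by (intro nn_integral_eq_integral) auto
  also have "(\<Prod>b\<in>(Basis::'a set). ennreal I) < \<infinity>"
    by (simp add: power_less_top_ennreal)
  finally show "(\<integral>\<^sup>+t. ennreal (norm (exp (- \<delta> * norm (t::'a)))) \<partial>lborel) < \<infinity>" .
qed auto

lemma exp_decay_bound:
  assumes "exp_decay f"
  obtains C \<delta> where "C \<ge> 0" "\<delta> > 0" "\<And>t. norm (f t) \<le> C * exp (- \<delta> * norm t)"
proof -
  obtain C \<delta> where "\<delta> > 0" and *: "\<And>t. norm (f t) \<le> C * exp (- \<delta> * norm t)"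
    using assms by (auto simp: exp_decay_def)
  moreover have "C \<ge> 0" using order_trans[OF norm_ge_zero *[of 0]] by simp
  ultimately show ?thesis using that by blast
qed

lemma exp_decayI:
  assumes "\<delta> > 0" and "\<And>t. norm (f t) \<le> C * exp (- \<delta> * norm t)"
  shows "exp_decay f"
  using assms by (auto simp: exp_decay_def)

lemma exp_decay_integrable:
  fixes f :: "'a::euclidean_space \<Rightarrow> 'b::{banach,second_countable_topology}"
  assumes "f \<in> borel_measurable borel" and "exp_decay f"
  shows "integrable lborel f"
proof -
  obtain C \<delta> where C: "C \<ge> 0" "\<delta> > 0" "\<And>t. norm (f t) \<le> C * exp (- \<delta> * norm t)"
    using exp_decay_bound[OF assms(2)] by blast
  show ?thesis
    by (rule Bochner_Integration.integrable_bound
        [OF integrable_mult_right[OF integrable_exp_neg_norm[OF C(2)], of C]])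
      (use C assms(1) in \<open>auto intro: order_trans\<close>)
qed

section \<open>Translation invariance and integrals of directional derivatives\<close>

lemma integral_translate:
  fixes f :: "'a::euclidean_space \<Rightarrow> 'b::{banach,second_countable_topology}"
  assumes "f \<in> borel_measurable borel"
  shows "integral\<^sup>L lborel (\<lambda>t. f (c + t)) = integral\<^sup>L lborel f"
    and "integrable lborel (\<lambda>t. f (c + t)) \<longleftrightarrow> integrable lborel f"
proof -
  have "integral\<^sup>L (distr lborel borel ((+) c)) f = integral\<^sup>L lborel (\<lambda>t. f (c + t))"
    by (rule integral_distr) (use assms in auto)
  then show "integral\<^sup>L lborel (\<lambda>t. f (c + t)) = integral\<^sup>L lborel f"
    by (simp add: lborel_distr_plus)
  have "integrable (distr lborel borel ((+) c)) f = integrable lborel (\<lambda>t. f (c + t))"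
    by (rule integrable_distr_eq) (use assms in auto)
  then show "integrable lborel (\<lambda>t. f (c + t)) \<longleftrightarrow> integrable lborel f"
    by (simp add: lborel_distr_plus)
qed

text \<open>Translation invariance takes the place of boundary terms: \<open>f (v + t) - f t\<close>
  has integral 0, and by the fundamental theorem of calculus and Fubini the same integral is the
  average over \<tau> in [0, 1] of the integrals of translates of \<open>f'\<close>, all
  equal.\<close>

lemma integral_directional_derivative_eq_0:
  fixes f f' :: "'a::euclidean_space \<Rightarrow> 'b::euclidean_space"
  assumes deriv: "\<And>t. ((\<lambda>\<tau>. f (t + \<tau> *\<^sub>R v)) has_vector_derivative f' t) (at 0)"
    and "continuous_on UNIV f'" and "integrable lborel f" and "integrable lborel f'"
  shows "integral\<^sup>L lborel f' = 0"
proof -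
  have meas: "f' \<in> borel_measurable borel"
    using assms(2) by (simp add: borel_measurable_continuous_onI)
  have meas_f: "f \<in> borel_measurable borel"
    using borel_measurable_integrable[OF assms(3)] by simp
  define F where "F \<tau> t = indicator {0..1::real} \<tau> *\<^sub>R f' (\<tau> *\<^sub>R v + t)" for \<tau> t
  \<comment> \<open>\<open>deriv\<close> concerns the parameter 0 only; used at the base point
    \<open>t + \<tau> *\<^sub>R v\<close> it yields the derivative at \<tau>.\<close>
  have deriv': "((\<lambda>\<tau>. f (t + \<tau> *\<^sub>R v)) has_vector_derivative f' (\<tau> *\<^sub>R v + t)) (at \<tau>)" for t \<tau>
  proof -
    have "((\<lambda>\<sigma>. f ((t + \<tau> *\<^sub>R v) + \<sigma> *\<^sub>R v)) has_vector_derivative f' (t + \<tau> *\<^sub>R v)) (at (- \<tau> + \<tau>))"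
      using deriv[of "t + \<tau> *\<^sub>R v"] by simp
    then have "((\<lambda>\<sigma>. f ((t + \<tau> *\<^sub>R v) + \<sigma> *\<^sub>R v)) \<circ> (\<lambda>\<sigma>. - \<tau> + \<sigma>) has_vector_derivative 1 *\<^sub>R f' (t + \<tau> *\<^sub>R v)) (at \<tau>)"
      by (intro vector_diff_chain_at) (auto intro!: derivative_eq_intros)
    moreover have "(\<lambda>\<sigma>. f ((t + \<tau> *\<^sub>R v) + \<sigma> *\<^sub>R v)) \<circ> (\<lambda>\<sigma>. - \<tau> + \<sigma>) = (\<lambda>\<tau>. f (t + \<tau> *\<^sub>R v))"
      by (simp add: fun_eq_iff algebra_simps)
    ultimately show ?thesis
      by (simp add: add.commute)
  qed
  have ftc: "(\<integral>\<tau>. F \<tau> t \<partial>lborel) = f (v + t) - f t" for t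
  proof -
    have "(\<integral>\<tau>. F \<tau> t \<partial>lborel) = f (t + 1 *\<^sub>R v) - f (t + 0 *\<^sub>R v)"
      unfolding F_def
      by (rule integral_FTC_Icc)
        (auto intro!: has_vector_derivative_at_within[OF deriv'] continuous_intros
          continuous_on_compose2[OF assms(2)])
    then show ?thesis by (simp add: add.commute)
  qed
  have Fmeas: "case_prod F \<in> borel_measurable (lborel \<Otimes>\<^sub>M lborel)"
    unfolding F_def using meas by measurable
  have "integrable (lborel \<Otimes>\<^sub>M lborel) (case_prod F)"
  proof (rule lborel_pair.Fubini_integrable[OF Fmeas])
    have "(\<integral>t. norm (case_prod F (\<tau>, t)) \<partial>lborel) = indicator {0..1} \<tau> * (\<integral>t. norm (f' t) \<partial>lborel)" for \<tau>
      using integral_translate(1)[of "\<lambda>t. norm (f' t)" "\<tau> *\<^sub>R v"] meas by (simp add: F_def)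
    then show "integrable lborel (\<lambda>\<tau>. \<integral>t. norm (case_prod F (\<tau>, t)) \<partial>lborel)" by simp
    show "AE \<tau> in lborel. integrable lborel (\<lambda>t. case_prod F (\<tau>, t))"
      using assms(4) meas by (auto simp: F_def integral_translate(2))
  qed
  from lborel_pair.Fubini_integral[OF this]
  have "(\<integral>t. f (v + t) - f t \<partial>lborel) = (\<integral>\<tau>. \<integral>t. F \<tau> t \<partial>lborel \<partial>lborel)"
    by (simp add: ftc)
  also have "(\<lambda>\<tau>. \<integral>t. F \<tau> t \<partial>lborel) = (\<lambda>\<tau>. indicator {0..1} \<tau> *\<^sub>R integral\<^sup>L lborel f')"
    unfolding F_def using integral_translate(1)[OF meas] by simp
  also have "integral\<^sup>L lborel \<dots> = integral\<^sup>L lborel f'"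
    by (subst integral_scaleR_left) auto
  also have "(\<integral>t. f (v + t) - f t \<partial>lborel) = 0"
    using assms(3) meas_f by (simp add: integral_translate)
  finally show ?thesis by simp
qed

section \<open>Exponential integrals as functions of a complex exponent\<close>

definition cdot :: "complex ^ 'n::finite \<Rightarrow> real ^ 'n \<Rightarrow> complex"
  where "cdot s t = (\<Sum>i\<in>UNIV. s $ i * of_real (t $ i))"

lemma cdot_add_left: "cdot (s + s') t = cdot s t + cdot s' t"
  by (simp add: cdot_def sum.distrib algebra_simps)

lemma continuous_on_cdot [continuous_intros]:
  "continuous_on S f \<Longrightarrow> continuous_on S (\<lambda>x. cdot s (f x))"
  unfolding cdot_def by (intro continuous_intros)

lemma norm_exp_cdot: "norm (exp (cdot s t)) = exp (Re_vec s \<bullet> t)"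
  by (simp add: cdot_def Re_vec_def inner_vec_def)

lemma norm_cdot_le:
  "norm (cdot (s :: complex ^ 'n::finite) t) \<le> real CARD('n) * norm s * norm t"
proof -
  have "norm (cdot s t) \<le> (\<Sum>i\<in>(UNIV::'n set). norm s * norm t)"
    unfolding cdot_def
  proof (intro sum_norm_le)
    fix i
    show "norm (s $ i * of_real (t $ i)) \<le> norm s * norm t"
      using Finite_Cartesian_Product.norm_nth_le[of s i] component_le_norm_cart[of t i]
      by (simp add: norm_mult mult_mono)
  qed
  then show ?thesis by simp
qed

lemma power2_le_exp:
  fixes u \<delta> :: real
  assumes "\<delta> > 0" "u \<ge> 0"
  shows "u\<^sup>2 \<le> 2 / \<delta>\<^sup>2 * exp (\<delta> * u)"
proof -
  have "1 + \<delta> * u + (\<delta> * u)\<^sup>2 / 2 \<le> exp (\<delta> * u)"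
    using assms by (intro exp_lower_Taylor_quadratic) auto
  then have "(\<delta> * u)\<^sup>2 / 2 \<le> exp (\<delta> * u)"
    using assms mult_nonneg_nonneg[of \<delta> u] by linarith
  then show ?thesis using assms by (simp add: field_simps)
qed

lemma exp_decay_norm_power2_mult:
  fixes f :: "'a::real_normed_vector \<Rightarrow> 'b::real_normed_vector"
  assumes "exp_decay f"
  shows "exp_decay (\<lambda>t. (norm t)\<^sup>2 *\<^sub>R f t)"
proof -
  obtain C \<delta> where C: "C \<ge> 0" "\<delta> > 0" "\<And>t. norm (f t) \<le> C * exp (- \<delta> * norm t)"
    using exp_decay_bound[OF assms] by blast
  have *: "norm ((norm t)\<^sup>2 *\<^sub>R f t) \<le> 2 / (\<delta> / 2)\<^sup>2 * C * exp (- (\<delta> / 2) * norm t)" for t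
  proof -
    have "norm ((norm t)\<^sup>2 *\<^sub>R f t) \<le> (2 / (\<delta> / 2)\<^sup>2 * exp (\<delta> / 2 * norm t)) * (C * exp (- \<delta> * norm t))"
      unfolding norm_scaleR
      using C(1,2) power2_le_exp[of "\<delta> / 2" "norm t"] C(3) by (intro mult_mono) auto
    also have "\<dots> = 2 / (\<delta> / 2)\<^sup>2 * C * (exp (\<delta> / 2 * norm t) * exp (- \<delta> * norm t))"
      by simp
    also have "exp (\<delta> / 2 * norm t) * exp (- \<delta> * norm t) = exp (- (\<delta> / 2) * norm t)"
      by (simp add: algebra_simps flip: exp_add)
    finally show ?thesis .
  qed
  show ?thesis by (rule exp_decayI[OF _ *]) (use C(2) in simp)
qed

lemma exp_decay_mono:
  fixes f :: "'a::real_normed_vector \<Rightarrow> 'b::real_normed_vector" and g :: "'a \<Rightarrow> 'c::real_normed_vector"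
  assumes "exp_decay f" and "\<And>t. norm (g t) \<le> K * norm (f t)" and "K \<ge> 0"
  shows "exp_decay g"
proof -
  obtain C \<delta> where C: "\<delta> > 0" "\<And>t. norm (f t) \<le> C * exp (- \<delta> * norm t)"
    using exp_decay_bound[OF assms(1)] by blast
  have "norm (g t) \<le> (K * C) * exp (- \<delta> * norm t)" for t
    using order_trans[OF assms(2) mult_left_mono[OF C(2) assms(3)]] by (simp add: mult.assoc)
  then show ?thesis using C(1) by (rule exp_decayI[rotated])
qed

lemma exp_decay_add:
  assumes "exp_decay f" "exp_decay g"
  shows "exp_decay (\<lambda>t. f t + g t)"
proof -
  obtain C \<delta> where C: "C \<ge> 0" "\<delta> > 0" "\<And>t. norm (f t) \<le> C * exp (- \<delta> * norm t)"
    using exp_decay_bound[OF assms(1)] by blast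
  obtain D \<epsilon> where D: "D \<ge> 0" "\<epsilon> > 0" "\<And>t. norm (g t) \<le> D * exp (- \<epsilon> * norm t)"
    using exp_decay_bound[OF assms(2)] by blast
  have "norm (f t + g t) \<le> (C + D) * exp (- min \<delta> \<epsilon> * norm t)" for t
  proof -
    have "norm (f t) \<le> C * exp (- min \<delta> \<epsilon> * norm t)"
      using C by (intro order_trans[OF C(3)] mult_left_mono) (auto simp: mult_right_mono)
    moreover have "norm (g t) \<le> D * exp (- min \<delta> \<epsilon> * norm t)"
      using D by (intro order_trans[OF D(3)] mult_left_mono) (auto simp: mult_right_mono)
    ultimately show ?thesis
      using norm_triangle_ineq[of "f t" "g t"] by (simp add: distrib_right)
  qed
  then show ?thesis using C(2) D(2) by (intro exp_decayI[of "min \<delta> \<epsilon>"]) auto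
qed

lemma exp_decay_component_mult:
  fixes f :: "real ^ 'n::finite \<Rightarrow> complex"
  assumes "exp_decay f"
  shows "exp_decay (\<lambda>t. of_real (t $ i) * f t)"
proof (rule exp_decay_mono[where K = 1])
  show "exp_decay (\<lambda>t. norm (f t) + norm ((norm t)\<^sup>2 *\<^sub>R f t))"
    by (intro exp_decay_add exp_decay_mono[OF assms, of _ 1]
        exp_decay_mono[OF exp_decay_norm_power2_mult[OF assms], of _ 1]) auto
  fix t
  \<comment> \<open>This reduces the linear factor to the constant and quadratic ones; it follows
    from \<open>(norm t - 1)\<^sup>2 \<ge> 0\<close>.\<close>
  have "\<bar>t $ i\<bar> \<le> 1 + (norm t)\<^sup>2"
    using component_le_norm_cart[of t i] zero_le_power2[of "norm t - 1"]
    by (simp add: power2_diff)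
  then have "\<bar>t $ i\<bar> * norm (f t) \<le> (1 + (norm t)\<^sup>2) * norm (f t)"
    by (rule mult_right_mono) simp
  then show "norm (of_real (t $ i) * f t) \<le> 1 * norm (norm (f t) + norm ((norm t)\<^sup>2 *\<^sub>R f t))"
    by (simp add: norm_mult distrib_right)
qed simp

text \<open>\<open>cdot\<close> is bilinear rather than Hermitian, so the integrand is holomorphic
  in \<open>s\<close>. For all small \<open>h\<close> the second-order Taylor remainder of the
  exponential is bounded by the square of \<open>norm h\<close> times one fixed integrable function,
  which yields the derivative with a quadratic error.\<close>

lemma has_derivative_exp_transform:
  fixes g :: "real ^ 'n::finite \<Rightarrow> complex" and s0 :: "complex ^ 'n"
  assumes meas [measurable]: "g \<in> borel_measurable borel"
    and dec: "exp_decay (\<lambda>t. exp (cdot s0 t) * g t)"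
  shows "((\<lambda>s. \<integral>t. exp (cdot s t) * g t \<partial>lborel) has_derivative
    (\<lambda>h. \<Sum>i\<in>UNIV. (\<integral>t. of_real (t $ i) * (exp (cdot s0 t) * g t) \<partial>lborel) * h $ i)) (at s0)"
proof -
  define f where "f t = exp (cdot s0 t) * g t" for t
  define n where "n = real CARD('n)"
  have n: "n > 0" by (simp add: n_def)
  have [measurable]: "(\<lambda>t. cdot s t) \<in> borel_measurable borel" for s :: "complex ^ 'n"
    by (intro borel_measurable_continuous_onI continuous_intros)
  have [measurable]: "f \<in> borel_measurable borel" unfolding f_def by measurable
  have fdec: "exp_decay f" using dec by (simp add: f_def[abs_def])
  obtain C \<delta> where C: "C \<ge> 0" "\<delta> > 0" "\<And>t. norm (f t) \<le> C * exp (- \<delta> * norm t)"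
    using exp_decay_bound[OF fdec] by blast
  define c where "c i = (\<integral>t. of_real (t $ i) * f t \<partial>lborel)" for i
  have int_f: "integrable lborel f" by (intro exp_decay_integrable fdec) measurable
  have [measurable]: "(\<lambda>t::real^'n. t $ i) \<in> borel_measurable borel" for i
    by (intro borel_measurable_continuous_onI continuous_intros)
  have int_c: "integrable lborel (\<lambda>t. of_real (t $ i) * f t)" for i
    by (intro exp_decay_integrable exp_decay_component_mult fdec) measurable
  \<comment> \<open>Envelope of the remainder: half of the rate \<delta> is spent on bounding
    \<open>exp (norm (cdot h t))\<close>.\<close>
  define E where "E t = (norm t)\<^sup>2 * (C * exp (- (\<delta> / 2) * norm t))" for t :: "real ^ 'n"
  have int_E: "integrable lborel E"
  proof (rule exp_decay_integrable)
    have "exp_decay (\<lambda>t::real^'n. C * exp (- (\<delta> / 2) * norm t))"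
      using C by (intro exp_decayI[of "\<delta> / 2" _ C]) auto
    from exp_decay_norm_power2_mult[OF this] show "exp_decay E"
      by (simp add: E_def[abs_def])
  qed (simp add: E_def[abs_def])
  \<comment> \<open>The radius within which \<open>norm (cdot h t)\<close> is at most \<delta> / 2
    times \<open>norm t\<close>; \<open>n\<close> is the constant of
    \<open>norm_cdot_le\<close>.\<close>
  define e where "e = \<delta> / (2 * n)"
  have "e > 0" using C n by (simp add: e_def)
  have small: "norm (cdot h t) \<le> \<delta> / 2 * norm t" if "norm h \<le> e" for h :: "complex ^ 'n" and t
  proof -
    have "norm (cdot h t) \<le> n * norm h * norm t" using norm_cdot_le[of h t] by (simp add: n_def)
    also have "\<dots> \<le> n * e * norm t" using that n by (intro mult_right_mono mult_left_mono) auto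
    finally show ?thesis using n by (simp add: e_def)
  qed
  have rem: "norm ((exp (cdot h t) - 1 - cdot h t) * f t) \<le> n\<^sup>2 * (norm h)\<^sup>2 * E t"
    if "norm h \<le> e" for h t
  proof -
    let ?w = "cdot h t"
    have "norm (exp ?w - 1 - ?w) \<le> exp (norm ?w) * (norm ?w)\<^sup>2"
      using Taylor_exp_field[of ?w 1] by (simp add: algebra_simps power2_eq_square)
    also have "\<dots> \<le> exp (\<delta> / 2 * norm t) * (n * norm h * norm t)\<^sup>2"
      using small[OF that, of t] norm_cdot_le[of h t]
      by (intro mult_mono power_mono) (auto simp: n_def)
    finally have "norm (exp ?w - 1 - ?w) * norm (f t) \<le>
        (exp (\<delta> / 2 * norm t) * (n * norm h * norm t)\<^sup>2) * (C * exp (- \<delta> * norm t))"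
      using C by (intro mult_mono) auto
    also have "\<dots> = n\<^sup>2 * (norm h)\<^sup>2 * ((norm t)\<^sup>2 * (C * (exp (\<delta> / 2 * norm t) * exp (- \<delta> * norm t))))"
      by (simp add: power_mult_distrib)
    also have "exp (\<delta> / 2 * norm t) * exp (- \<delta> * norm t) = exp (- (\<delta> / 2) * norm t)"
      by (simp add: algebra_simps flip: exp_add)
    finally show ?thesis by (simp add: norm_mult E_def)
  qed
  define K where "K = n\<^sup>2 * integral\<^sup>L lborel E"
  have eq: "exp (cdot (s0 + h) t) * g t = (exp (cdot h t) - 1 - cdot h t) * f t + f t + (\<Sum>i\<in>UNIV. (of_real (t $ i) * f t) * h $ i)" for h t
  proof -
    have "(\<Sum>i\<in>UNIV. (of_real (t $ i) * f t) * h $ i) = cdot h t * f t"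
      unfolding cdot_def sum_distrib_right by (intro sum.cong) (simp_all add: ac_simps)
    then show ?thesis by (simp add: f_def cdot_add_left exp_add algebra_simps)
  qed
  have diff: "norm ((\<integral>t. exp (cdot (s0 + h) t) * g t \<partial>lborel) - (\<integral>t. exp (cdot s0 t) * g t \<partial>lborel) - (\<Sum>i\<in>UNIV. c i * h $ i)) \<le> K * (norm h)\<^sup>2"
    if h: "norm h \<le> e" for h
  proof -
    have int_r: "integrable lborel (\<lambda>t. (exp (cdot h t) - 1 - cdot h t) * f t)"
    proof (rule Bochner_Integration.integrable_bound)
      show "integrable lborel (\<lambda>t. n\<^sup>2 * (norm h)\<^sup>2 * E t)" using int_E by simp
      have "norm ((exp (cdot h t) - 1 - cdot h t) * f t) \<le> norm (n\<^sup>2 * (norm h)\<^sup>2 * E t)" for t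
        by (rule order_trans[OF rem[OF h]]) (simp add: abs_ge_self)
      then show "AE t in lborel. norm ((exp (cdot h t) - 1 - cdot h t) * f t) \<le> norm (n\<^sup>2 * (norm h)\<^sup>2 * E t)"
        by simp
    qed measurable
    have "(\<integral>t. exp (cdot (s0 + h) t) * g t \<partial>lborel)
        = (\<integral>t. (exp (cdot h t) - 1 - cdot h t) * f t \<partial>lborel) + integral\<^sup>L lborel f + (\<Sum>i\<in>UNIV. c i * h $ i)"
      unfolding eq c_def using int_r int_f int_c by simp
    then have "norm ((\<integral>t. exp (cdot (s0 + h) t) * g t \<partial>lborel) - (\<integral>t. exp (cdot s0 t) * g t \<partial>lborel) - (\<Sum>i\<in>UNIV. c i * h $ i))
        = norm (\<integral>t. (exp (cdot h t) - 1 - cdot h t) * f t \<partial>lborel)"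
      by (simp add: f_def[abs_def])
    also have "\<dots> \<le> (\<integral>t. n\<^sup>2 * (norm h)\<^sup>2 * E t \<partial>lborel)"
      by (rule Bochner_Integration.integral_norm_bound_integral) (use int_r int_E rem[OF h] in auto)
    also have "\<dots> = K * (norm h)\<^sup>2" by (simp add: K_def)
    finally show ?thesis .
  qed
  have "((\<lambda>s. \<integral>t. exp (cdot s t) * g t \<partial>lborel) has_derivative (\<lambda>h. \<Sum>i\<in>UNIV. c i * h $ i)) (at s0)"
  proof (rule has_derivativeI_sandwich[where H = "\<lambda>s. K * norm (s - s0)" and e = e])
    show "bounded_linear (\<lambda>h::complex^'n. \<Sum>i\<in>UNIV. c i * h $ i)"
      by (intro bounded_linear_sum bounded_linear_const_mult bounded_linear_vec_nth)
    have "((\<lambda>s. K * norm (s - s0)) \<longlongrightarrow> K * norm (s0 - s0)) (at s0)"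
      by (intro tendsto_intros)
    then show "((\<lambda>s. K * norm (s - s0)) \<longlongrightarrow> 0) (at s0)" by simp
    fix s assume s: "s \<noteq> s0" "dist s s0 < e"
    show "norm ((\<integral>t. exp (cdot s t) * g t \<partial>lborel) - (\<integral>t. exp (cdot s0 t) * g t \<partial>lborel) - (\<Sum>i\<in>UNIV. c i * (s - s0) $ i)) / norm (s - s0) \<le> K * norm (s - s0)"
      using diff[of "s - s0"] s by (simp add: dist_norm divide_le_eq power2_eq_square mult.assoc)
  qed (use \<open>e > 0\<close> in auto)
  then show ?thesis by (simp add: c_def f_def)
qed

subsection \<open>Logarithmic coordinates\<close>

definition exp_vec :: "real ^ 'n \<Rightarrow> real ^ 'n"
  where "exp_vec t = (\<chi> i. exp (t $ i))"

definition ln_vec :: "real ^ 'n \<Rightarrow> real ^ 'n"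
  where "ln_vec x = (\<chi> i. ln (x $ i))"

lemma exp_vec_nth [simp]: "exp_vec t $ i = exp (t $ i)"
  by (simp add: exp_vec_def)

lemma exp_ln_vec: "x \<in> pos_orthant \<Longrightarrow> exp_vec (ln_vec x) = x"
  by (simp add: vec_eq_iff ln_vec_def pos_orthant_def)

lemma exp_vec_pos: "exp_vec t \<in> pos_orthant"
  by (simp add: pos_orthant_def)

lemma prod_Basis_cart:
  fixes x :: "real ^ 'n::finite" and f :: "real ^ 'n \<Rightarrow> real \<Rightarrow> 'c::comm_monoid_mult"
  shows "(\<Prod>b\<in>Basis. f b (x \<bullet> b)) = (\<Prod>i\<in>UNIV. f (axis i 1) (x $ i))"
proof -
  have Basis: "Basis = (\<lambda>i::'n. axis i (1::real)) ` UNIV"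
    by (auto simp: Basis_vec_def)
  have "inj (\<lambda>i::'n. axis i (1::real))" by (auto simp: inj_def axis_eq_axis)
  then show ?thesis
    unfolding Basis by (subst prod.reindex) (simp_all add: o_def inner_axis)
qed

lemma measurable_ln_vec [measurable]: "(ln_vec :: real ^ 'n::finite \<Rightarrow> _) \<in> borel_measurable borel"
proof (subst borel_measurable_euclidean_space, intro ballI)
  fix b :: "real ^ 'n" assume "b \<in> Basis"
  then obtain i where b: "b = axis i 1" by (auto simp: Basis_vec_def)
  have "(\<lambda>x::real^'n. x $ i) \<in> borel_measurable borel"
    by (intro borel_measurable_continuous_onI continuous_intros)
  then show "(\<lambda>x. ln_vec x \<bullet> b) \<in> borel_measurable borel"
    by (simp add: b inner_axis ln_vec_def)
qed

text \<open>The density of d\<epsilon> / \<epsilon>, cut off to the open orthant so that the default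
  values of \<open>ln\<close> at non-positive arguments carry no mass.\<close>

definition mult_haar_weight :: "real ^ 'n::finite \<Rightarrow> real"
  where "mult_haar_weight x = indicator pos_orthant x * (\<Prod>i\<in>UNIV. 1 / x $ i)"

lemma open_pos_orthant: "open (pos_orthant :: (real ^ 'n::finite) set)"
proof -
  have "pos_orthant = (\<Inter>i\<in>UNIV. {x :: real ^ 'n. 0 < x $ i})"
    by (auto simp: pos_orthant_def)
  also have "open \<dots>"
    by (intro open_INT ballI open_Collect_less continuous_intros) auto
  finally show ?thesis .
qed

lemma measurable_mult_haar_weight [measurable]:
  "(mult_haar_weight :: real ^ 'n::finite \<Rightarrow> _) \<in> borel_measurable borel"
proof -
  have "(\<lambda>x::real^'n. x $ i) \<in> borel_measurable borel" for i
    by (intro borel_measurable_continuous_onI continuous_intros)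
  moreover have "(pos_orthant :: (real ^ 'n) set) \<in> sets borel"
    using open_pos_orthant by (rule borel_open)
  ultimately show ?thesis unfolding mult_haar_weight_def by measurable
qed

lemma nn_integral_inverse_exp_interval:
  fixes a b :: real
  assumes "a \<le> b"
  shows "(\<integral>\<^sup>+y. ennreal (1 / y * indicator {exp a<..<exp b} y) \<partial>lborel) = ennreal (b - a)"
proof -
  have "(\<integral>\<^sup>+y. ennreal (1 / y * indicator {exp a<..<exp b} y) \<partial>lborel)
      = (\<integral>\<^sup>+y. ennreal (1 / y) * indicator {exp a..exp b} y \<partial>lborel)"
    by (intro nn_integral_cong_AE eventually_mono[OF eventually_conj[OF
          AE_lborel_singleton[of "exp a"] AE_lborel_singleton[of "exp b"]]])
      (auto simp: indicator_def)
  also have "\<dots> = ennreal (ln (exp b) - ln (exp a))"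
  proof (rule nn_integral_FTC_Icc)
    fix y assume "y \<in> {exp a..exp b}"
    then have "y > 0" by (auto intro: less_le_trans[OF exp_gt_zero])
    then show "(ln has_real_derivative 1 / y) (at y)" "0 \<le> 1 / y"
      by (auto intro: DERIV_ln_divide)
  qed (use assms in auto)
  finally show ?thesis by simp
qed

text \<open>Lebesgue measure is determined by boxes. On the orthant the preimage of a box is a
  product of intervals with exponentiated endpoints, so its mass factorises, and dy / y gives each
  factor the length of the original side.\<close>

lemma lborel_eq_distr_ln_vec:
  "(lborel :: (real ^ 'n::finite) measure) = distr (density lborel (\<lambda>x. ennreal (mult_haar_weight x))) borel ln_vec"
proof (rule lborel_eqI)
  fix l u :: "real ^ 'n"
  assume lu: "\<And>b. b \<in> Basis \<Longrightarrow> l \<bullet> b \<le> u \<bullet> b"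
  define f where "f b y = 1 / y * indicator {exp (l \<bullet> b)<..<exp (u \<bullet> b)} y" for b y
  have eq: "ennreal (mult_haar_weight x) * indicator (ln_vec -` box l u) x = (\<Prod>b\<in>Basis. ennreal (f b (x \<bullet> b)))" for x
  proof -
    have fpos: "0 \<le> f b y" for b y
      by (auto simp: f_def indicator_def intro: less_imp_le less_trans[OF exp_gt_zero])
    have "mult_haar_weight x * indicator (ln_vec -` box l u) x = (\<Prod>i\<in>UNIV. f (axis i 1) (x $ i))"
    proof (cases "\<forall>i. exp (l $ i) < x $ i \<and> x $ i < exp (u $ i)")
      case True
      then have pos: "0 < x $ i" for i by (meson exp_gt_zero less_trans)
      have "l $ i < ln (x $ i)" "ln (x $ i) < u $ i" for i
        using True pos[of i] by (simp_all add: exp_less_cancel_iff[of "l $ i" "ln (x $ i)", symmetric]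
            exp_less_cancel_iff[of "ln (x $ i)" "u $ i", symmetric] del: exp_less_cancel_iff)
      then have "ln_vec x \<in> box l u" by (simp add: mem_box_cart ln_vec_def)
      then show ?thesis
        using True pos by (simp add: mult_haar_weight_def f_def pos_orthant_def inner_axis)
    next
      case False
      then obtain i where i: "\<not> (exp (l $ i) < x $ i \<and> x $ i < exp (u $ i))" by blast
      have "(\<Prod>i\<in>UNIV. f (axis i 1) (x $ i)) = 0"
        using i by (intro prod_zero bexI[of _ i]) (auto simp: f_def inner_axis indicator_def)
      moreover have "x \<notin> pos_orthant \<or> ln_vec x \<notin> box l u"
      proof (rule ccontr)
        assume "\<not> ?thesis"
        then have "0 < x $ i" "l $ i < ln (x $ i)" "ln (x $ i) < u $ i"
          by (auto simp: pos_orthant_def mem_box_cart ln_vec_def)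
        then show False
          using i exp_less_mono[of "l $ i" "ln (x $ i)"] exp_less_mono[of "ln (x $ i)" "u $ i"] by simp
      qed
      ultimately show ?thesis by (auto simp: mult_haar_weight_def)
    qed
    also have "\<dots> = (\<Prod>b\<in>Basis. f b (x \<bullet> b))" by (simp add: prod_Basis_cart)
    finally have "ennreal (mult_haar_weight x * indicator (ln_vec -` box l u) x) = (\<Prod>b\<in>Basis. ennreal (f b (x \<bullet> b)))"
      using fpos by (simp add: prod_ennreal)
    then show ?thesis by (auto simp: indicator_def)
  qed
  have [measurable]: "f b \<in> borel_measurable borel" for b
    unfolding f_def by measurable
  have "ln_vec -` box l u \<in> sets borel"
    using measurable_sets[OF measurable_ln_vec, of "box l u"] by simp
  then have "emeasure (distr (density lborel (\<lambda>x. ennreal (mult_haar_weight x))) borel ln_vec) (box l u)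
      = (\<integral>\<^sup>+x. ennreal (mult_haar_weight x) * indicator (ln_vec -` box l u) x \<partial>lborel)"
    by (subst emeasure_distr) (auto simp: emeasure_density)
  also have "\<dots> = (\<Prod>b\<in>Basis. \<integral>\<^sup>+y. ennreal (f b y) \<partial>lborel)"
    unfolding eq by (rule nn_integral_lborel_prod) auto
  also have "\<dots> = (\<Prod>b\<in>Basis. ennreal ((u - l) \<bullet> b))"
    unfolding f_def using lu
    by (intro prod.cong refl) (simp only: nn_integral_inverse_exp_interval inner_diff_left)
  finally show "emeasure (distr (density lborel (\<lambda>x. ennreal (mult_haar_weight x))) borel ln_vec) (box l u)
      = ennreal (\<Prod>b\<in>Basis. (u - l) \<bullet> b)"
    using lu by (simp add: prod_ennreal inner_diff_left)
qed simp

lemma integral_exp_vec: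
  fixes F :: "real ^ 'n::finite \<Rightarrow> complex"
  assumes [measurable]: "(\<lambda>t. F (exp_vec t)) \<in> borel_measurable borel"
  defines "G \<equiv> \<lambda>x. F x * (\<Prod>i\<in>UNIV. 1 / complex_of_real (x $ i))"
  shows "set_integrable lborel pos_orthant G \<longleftrightarrow> integrable lborel (\<lambda>t. F (exp_vec t))"
    and "set_lebesgue_integral lborel pos_orthant G = integral\<^sup>L lborel (\<lambda>t. F (exp_vec t))"
proof -
  let ?D = "density lborel (\<lambda>x. ennreal (mult_haar_weight x))"
  have nonneg: "AE x in lborel. 0 \<le> mult_haar_weight (x :: real ^ 'n)"
    by (intro AE_I2) (auto simp: mult_haar_weight_def indicator_def pos_orthant_def less_imp_le intro!: prod_nonneg)
  have eq: "mult_haar_weight x *\<^sub>R F (exp_vec (ln_vec x)) = indicator pos_orthant x *\<^sub>R G x" for x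
    by (cases "x \<in> pos_orthant")
      (simp_all add: mult_haar_weight_def G_def exp_ln_vec scaleR_conv_of_real)
  have "integrable lborel (\<lambda>t. F (exp_vec t)) \<longleftrightarrow> integrable ?D (\<lambda>x. F (exp_vec (ln_vec x)))"
    by (subst lborel_eq_distr_ln_vec, subst integrable_distr_eq) auto
  also have "\<dots> \<longleftrightarrow> integrable lborel (\<lambda>x. mult_haar_weight x *\<^sub>R F (exp_vec (ln_vec x)))"
    by (rule integrable_density) (use nonneg in auto)
  finally show "set_integrable lborel pos_orthant G \<longleftrightarrow> integrable lborel (\<lambda>t. F (exp_vec t))"
    by (simp add: eq set_integrable_def)
  have "integral\<^sup>L lborel (\<lambda>t. F (exp_vec t)) = integral\<^sup>L ?D (\<lambda>x. F (exp_vec (ln_vec x)))"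
    by (subst lborel_eq_distr_ln_vec, subst integral_distr) auto
  also have "\<dots> = integral\<^sup>L lborel (\<lambda>x. mult_haar_weight x *\<^sub>R F (exp_vec (ln_vec x)))"
    by (rule integral_density) (use nonneg in auto)
  finally show "set_lebesgue_integral lborel pos_orthant G = integral\<^sup>L lborel (\<lambda>t. F (exp_vec t))"
    by (simp add: eq set_lebesgue_integral_def)
qed

subsection \<open>Holomorphy in several variables\<close>

text \<open>A pointwise notion lets the closure rules be stated without open sets; coefficients
  given as a function can be written down directly for sums and products.\<close>

definition holomorphic_Cn_at :: "(complex ^ 'n::finite \<Rightarrow> complex) \<Rightarrow> complex ^ 'n \<Rightarrow> bool"
  where "holomorphic_Cn_at f s \<longleftrightarrow>
    (\<exists>c :: 'n \<Rightarrow> complex. (f has_derivative (\<lambda>h. \<Sum>i\<in>UNIV. c i * h $ i)) (at s))"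

lemma holomorphic_Cn_on_iff:
  fixes f :: "complex ^ 'n::finite \<Rightarrow> complex"
  shows "holomorphic_Cn_on f U \<longleftrightarrow> (\<forall>s\<in>U. holomorphic_Cn_at f s)"
proof -
  have "(\<exists>c :: complex ^ 'n. (f has_derivative (\<lambda>h. \<Sum>i\<in>UNIV. c $ i * h $ i)) (at s)) \<longleftrightarrow> holomorphic_Cn_at f s" for s
    unfolding holomorphic_Cn_at_def
  proof
    assume "\<exists>c :: 'n \<Rightarrow> complex. (f has_derivative (\<lambda>h. \<Sum>i\<in>UNIV. c i * h $ i)) (at s)"
    then obtain c where "(f has_derivative (\<lambda>h. \<Sum>i\<in>UNIV. c i * h $ i)) (at s)" by blast
    then show "\<exists>c :: complex ^ 'n. (f has_derivative (\<lambda>h. \<Sum>i\<in>UNIV. c $ i * h $ i)) (at s)"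
      by (intro exI[of _ "\<chi> i. c i"]) simp
  qed blast
  then show ?thesis by (simp add: holomorphic_Cn_on_def)
qed

named_theorems holomorphic_Cn_intros

lemma holomorphic_Cn_at_const [holomorphic_Cn_intros]: "holomorphic_Cn_at (\<lambda>_. a) s"
  unfolding holomorphic_Cn_at_def by (intro exI[of _ "\<lambda>_. 0"]) simp

lemma holomorphic_Cn_at_nth [holomorphic_Cn_intros]: "holomorphic_Cn_at (\<lambda>s. s $ i) (s :: complex ^ 'n::finite)"
proof -
  have "(\<lambda>h::complex^'n. \<Sum>j\<in>UNIV. (if j = i then 1 else 0) * h $ j) = (\<lambda>h. h $ i)"
    by (simp add: if_distrib[of "\<lambda>x. x * _"] cong: if_cong)
  moreover have "((\<lambda>s::complex^'n. s $ i) has_derivative (\<lambda>h. h $ i)) (at s)"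
    by (rule bounded_linear_imp_has_derivative) (rule bounded_linear_vec_nth)
  ultimately show ?thesis
    unfolding holomorphic_Cn_at_def by (intro exI[of _ "\<lambda>j. if j = i then 1 else 0"]) simp
qed

lemma holomorphic_Cn_at_add [holomorphic_Cn_intros]:
  assumes "holomorphic_Cn_at f s" "holomorphic_Cn_at g s"
  shows "holomorphic_Cn_at (\<lambda>s. f s + g s) s"
proof -
  obtain c d where "(f has_derivative (\<lambda>h. \<Sum>i\<in>UNIV. c i * h $ i)) (at s)"
    "(g has_derivative (\<lambda>h. \<Sum>i\<in>UNIV. d i * h $ i)) (at s)"
    using assms by (auto simp: holomorphic_Cn_at_def)
  from has_derivative_add[OF this] show ?thesis
    unfolding holomorphic_Cn_at_def
    by (intro exI[of _ "\<lambda>i. c i + d i"]) (simp add: distrib_right sum.distrib)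
qed

lemma holomorphic_Cn_at_mult [holomorphic_Cn_intros]:
  assumes "holomorphic_Cn_at f s" "holomorphic_Cn_at g s"
  shows "holomorphic_Cn_at (\<lambda>s. f s * g s) s"
proof -
  obtain c d where "(f has_derivative (\<lambda>h. \<Sum>i\<in>UNIV. c i * h $ i)) (at s)"
    "(g has_derivative (\<lambda>h. \<Sum>i\<in>UNIV. d i * h $ i)) (at s)"
    using assms by (auto simp: holomorphic_Cn_at_def)
  from has_derivative_mult[OF this]
  have "((\<lambda>s. f s * g s) has_derivative (\<lambda>h. \<Sum>i\<in>UNIV. (f s * d i + c i * g s) * h $ i)) (at s)"
    by (rule has_derivative_eq_rhs)
      (simp add: fun_eq_iff sum.distrib sum_distrib_left sum_distrib_right algebra_simps)
  then show ?thesis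
    unfolding holomorphic_Cn_at_def by (rule exI[of _ "\<lambda>i. f s * d i + c i * g s"])
qed

lemma holomorphic_Cn_at_compose:
  assumes "(f has_field_derivative f') (at (g s))" "holomorphic_Cn_at g s"
  shows "holomorphic_Cn_at (\<lambda>s. f (g s)) s"
proof -
  obtain c where c: "(g has_derivative (\<lambda>h. \<Sum>i\<in>UNIV. c i * h $ i)) (at s)"
    using assms(2) by (auto simp: holomorphic_Cn_at_def)
  have "((\<lambda>s. f (g s)) has_derivative (\<lambda>h. \<Sum>i\<in>UNIV. (f' * c i) * h $ i)) (at s)"
    using has_derivative_compose[OF c assms(1)[unfolded has_field_derivative_def]]
    by (rule has_derivative_eq_rhs) (simp add: fun_eq_iff sum_distrib_left mult_ac)
  then show ?thesis
    unfolding holomorphic_Cn_at_def by (rule exI[of _ "\<lambda>i. f' * c i"])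
qed

lemma holomorphic_Cn_at_sum [holomorphic_Cn_intros]:
  assumes "\<And>j. j \<in> J \<Longrightarrow> holomorphic_Cn_at (f j) s"
  shows "holomorphic_Cn_at (\<lambda>s. \<Sum>j\<in>J. f j s) s"
  using assms by (induction J rule: infinite_finite_induct) (auto intro: holomorphic_Cn_intros)

lemma holomorphic_Cn_at_prod [holomorphic_Cn_intros]:
  assumes "\<And>j. j \<in> J \<Longrightarrow> holomorphic_Cn_at (f j) s"
  shows "holomorphic_Cn_at (\<lambda>s. \<Prod>j\<in>J. f j s) s"
  using assms by (induction J rule: infinite_finite_induct) (auto intro: holomorphic_Cn_intros)

lemma holomorphic_Cn_at_rGamma [holomorphic_Cn_intros]:
  assumes "holomorphic_Cn_at g s"
  shows "holomorphic_Cn_at (\<lambda>s. rGamma (g s)) s"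
  by (rule holomorphic_Cn_at_compose[OF _ assms])
    (rule field_differentiable_rGamma[THEN field_differentiable_derivI])

lemma holomorphic_Cn_at_pairing [holomorphic_Cn_intros]:
  "holomorphic_Cn_at (\<lambda>s. pairing \<mu> s) s"
  unfolding pairing_def by (intro holomorphic_Cn_intros)

lemma holomorphic_Cn_at_shift:
  assumes "holomorphic_Cn_at f (s + a)"
  shows "holomorphic_Cn_at (\<lambda>s. f (s + a)) s"
proof -
  obtain c where c: "(f has_derivative (\<lambda>h. \<Sum>i\<in>UNIV. c i * h $ i)) (at (s + a))"
    using assms by (auto simp: holomorphic_Cn_at_def)
  have "((\<lambda>s. s + a) has_derivative (\<lambda>h. h)) (at s)"
    by (auto intro!: derivative_eq_intros)
  from has_derivative_compose[OF this c] show ?thesis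
    unfolding holomorphic_Cn_at_def by blast
qed

lemma holomorphic_Cn_at_transform:
  assumes "holomorphic_Cn_at f s" "open U" "s \<in> U" "\<And>w. w \<in> U \<Longrightarrow> f w = g w"
  shows "holomorphic_Cn_at g s"
  using assms has_derivative_transform_within_open unfolding holomorphic_Cn_at_def by blast

subsection \<open>Decay of the integrand\<close>

lemma to_real_vec_nth [simp]: "to_real_vec \<alpha> $ i = real (\<alpha> $ i)"
  by (simp add: to_real_vec_def)

lemma inj_to_real_vec: "inj to_real_vec"
  by (auto simp: inj_def vec_eq_iff)

lemma monom_at_exp_vec: "monom_at \<alpha> (exp_vec t) = exp (to_real_vec \<alpha> \<bullet> t)"
  by (simp add: monom_at_def inner_vec_def exp_sum exp_of_nat_mult flip: exp_of_nat2_mult)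

lemma lookup_truncation:
  "Poly_Mapping.lookup (truncation p \<Gamma>) \<beta> =
    (if to_real_vec \<beta> \<in> \<Gamma> then Poly_Mapping.lookup p \<beta> else 0)"
proof -
  have "Poly_Mapping.lookup (truncation p \<Gamma>) \<beta> =
      (\<Sum>\<alpha> | \<alpha> \<in> Poly_Mapping.keys p \<and> to_real_vec \<alpha> \<in> \<Gamma>. if \<alpha> = \<beta> then Poly_Mapping.lookup p \<alpha> else 0)"
    by (simp add: truncation_def lookup_sum lookup_single when_def)
  also have "\<dots> = (if to_real_vec \<beta> \<in> \<Gamma> then Poly_Mapping.lookup p \<beta> else 0)"
    by (subst sum.delta) (auto simp: in_keys_iff)
  finally show ?thesis .
qed

lemma poly_at_truncation:
  "poly_at (truncation p \<Gamma>) x =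
    (\<Sum>\<alpha> | \<alpha> \<in> Poly_Mapping.keys p \<and> to_real_vec \<alpha> \<in> \<Gamma>.
      Poly_Mapping.lookup p \<alpha> * complex_of_real (monom_at \<alpha> x))"
proof -
  have "Poly_Mapping.keys (truncation p \<Gamma>) = {\<alpha>. \<alpha> \<in> Poly_Mapping.keys p \<and> to_real_vec \<alpha> \<in> \<Gamma>}"
    by (auto simp: in_keys_iff lookup_truncation split: if_splits)
  then show ?thesis
    unfolding poly_at_def by (intro sum.cong) (auto simp: lookup_truncation)
qed

lemma completely_nonvanishing_lower_bound:
  fixes p :: "'n::finite cpoly"
  assumes "completely_nonvanishing_on p pos_orthant"
  shows "\<exists>c>0. \<forall>t. c * (\<Sum>\<alpha>\<in>Poly_Mapping.keys p. exp (to_real_vec \<alpha> \<bullet> t)) \<le> norm (poly_at p (exp_vec t))"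
proof -
  let ?K = "Poly_Mapping.keys p"
  \<comment> \<open>The bound for exponential sums is indexed by real vectors, so coefficients are
    pulled back along the injective \<open>to_real_vec\<close>.\<close>
  define a where "a v = Poly_Mapping.lookup p (inv to_real_vec v)" for v :: "real ^ 'n"
  have a: "a (to_real_vec \<alpha>) = Poly_Mapping.lookup p \<alpha>" for \<alpha>
    by (simp add: a_def inj_to_real_vec)
  have inj: "inj_on to_real_vec B" for B :: "(nat ^ 'n) set"
    using inj_to_real_vec by (rule inj_on_subset) simp
  have "poly_at p (exp_vec 0) \<noteq> 0"
    using assms exp_vec_pos by (auto simp: completely_nonvanishing_on_def)
  then have "?K \<noteq> {}" by (auto simp: poly_at_def)
  have "\<exists>c>0. \<forall>t. c * (\<Sum>v\<in>to_real_vec ` ?K. exp (v \<bullet> t)) \<le>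
      norm (\<Sum>v\<in>to_real_vec ` ?K. a v * of_real (exp (v \<bullet> t)))"
  proof (rule exp_sum_lower_bound)
    fix \<Gamma> y
    assume \<Gamma>: "\<Gamma> face_of convex hull (to_real_vec ` ?K)" "\<Gamma> \<noteq> {}"
    have "to_real_vec ` ?K \<inter> \<Gamma> = to_real_vec ` {\<alpha>. \<alpha> \<in> ?K \<and> to_real_vec \<alpha> \<in> \<Gamma>}" by auto
    then have "(\<Sum>v\<in>to_real_vec ` ?K \<inter> \<Gamma>. a v * of_real (exp (v \<bullet> y))) = poly_at (truncation p \<Gamma>) (exp_vec y)"
      by (simp add: sum.reindex inj poly_at_truncation a monom_at_exp_vec)
    then show "(\<Sum>v\<in>to_real_vec ` ?K \<inter> \<Gamma>. a v * of_real (exp (v \<bullet> y))) \<noteq> 0"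
      using assms \<Gamma> exp_vec_pos[of y] by (auto simp: completely_nonvanishing_on_def newton_polytope_def)
  qed (use \<open>?K \<noteq> {}\<close> in auto)
  then show ?thesis
    by (simp add: sum.reindex inj a poly_at_def monom_at_exp_vec)
qed

section \<open>Rapid decay in logarithmic coordinates\<close>

lemma closed_nonneg_orthant: "closed (nonneg_orthant :: (real ^ 'n::finite) set)"
proof -
  have "nonneg_orthant = (\<Inter>i\<in>UNIV. {x :: real ^ 'n. 0 \<le> x $ i})"
    by (auto simp: nonneg_orthant_def)
  also have "closed \<dots>"
    by (intro closed_INT ballI closed_Collect_le continuous_intros)
  finally show ?thesis .
qed

lemma bounded_on_closed_of_tendsto_0:
  fixes f :: "'a::euclidean_space \<Rightarrow> complex"
  assumes "closed S" "continuous_on S f" "(f \<longlongrightarrow> 0) (inf at_infinity (principal S))"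
  shows "\<exists>C\<ge>0. \<forall>x\<in>S. norm (f x) \<le> C"
proof -
  have "\<forall>\<^sub>F x in inf at_infinity (principal S). norm (f x) < 1"
    using assms(3) tendsto_norm_zero order_tendstoD(2) zero_less_one by blast
  then obtain b where b: "\<And>x. b \<le> norm x \<Longrightarrow> x \<in> S \<Longrightarrow> norm (f x) < 1"
    by (auto simp: eventually_inf_principal eventually_at_infinity)
  have "compact (f ` (S \<inter> cball 0 b))"
    by (intro compact_continuous_image continuous_on_subset[OF assms(2)] closed_Int_compact assms(1)) auto
  then obtain C where C: "\<And>x. x \<in> S \<Longrightarrow> norm x \<le> b \<Longrightarrow> norm (f x) \<le> C"
    by (force dest!: compact_imp_bounded simp: bounded_iff)
  have "norm (f x) \<le> max 1 C" if "x \<in> S" for x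
    using b[of x] C[of x] that by (cases "norm x \<le> b") auto
  then show ?thesis by (intro exI[of _ "max 1 C"]) auto
qed

lemma exp_vec_nonneg: "exp_vec t \<in> nonneg_orthant"
  by (simp add: nonneg_orthant_def)

text \<open>For given \<open>t\<close> the exponential of the positive parts is a single monomial,
  with exponent \<open>K\<close> on the coordinates where \<open>t\<close> is non-negative. Only
  finitely many coordinate sets occur, so the sum of their constants bounds all cases.\<close>

lemma rapid_decay_exp_vec:
  fixes f :: "real ^ 'n::finite \<Rightarrow> complex"
  assumes "continuous_on nonneg_orthant f"
    and "\<And>\<alpha>. ((\<lambda>x. complex_of_real (monom_at \<alpha> x) * f x) \<longlongrightarrow> 0) (inf at_infinity (principal nonneg_orthant))"
  shows "\<exists>C\<ge>0. \<forall>t. norm (f (exp_vec t)) * exp (real K * (\<Sum>i\<in>UNIV. max 0 (t $ i))) \<le> C"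
proof -
  have "\<exists>C\<ge>0. \<forall>x\<in>nonneg_orthant. norm (complex_of_real (monom_at \<alpha> x) * f x) \<le> C" for \<alpha>
    unfolding monom_at_def
    by (intro bounded_on_closed_of_tendsto_0 closed_nonneg_orthant assms(2)[unfolded monom_at_def]
        continuous_intros assms(1))
  then obtain C where C0: "\<And>\<alpha>. C \<alpha> \<ge> 0"
    and C: "\<And>\<alpha> x. x \<in> nonneg_orthant \<Longrightarrow> norm (complex_of_real (monom_at \<alpha> x) * f x) \<le> C \<alpha>"
    by metis
  define \<alpha> where "\<alpha> I = (\<chi> i. if i \<in> I then K else 0)" for I :: "'n set"
  have "norm (f (exp_vec t)) * exp (real K * (\<Sum>i\<in>UNIV. max 0 (t $ i))) \<le> (\<Sum>I\<in>UNIV. C (\<alpha> I))" for t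
  proof -
    define I where "I = {i. t $ i \<ge> 0}"
    have "real K * (\<Sum>i\<in>UNIV. max 0 (t $ i)) = to_real_vec (\<alpha> I) \<bullet> t"
      unfolding inner_vec_def sum_distrib_left
      by (intro sum.cong) (auto simp: \<alpha>_def I_def max_def)
    then have "norm (f (exp_vec t)) * exp (real K * (\<Sum>i\<in>UNIV. max 0 (t $ i)))
        = norm (complex_of_real (monom_at (\<alpha> I) (exp_vec t)) * f (exp_vec t))"
      by (simp add: norm_mult monom_at_exp_vec)
    also have "\<dots> \<le> C (\<alpha> I)" by (intro C exp_vec_nonneg)
    also have "\<dots> \<le> (\<Sum>I\<in>UNIV. C (\<alpha> I))" by (intro member_le_sum) (auto simp: C0)
    finally show ?thesis .
  qed
  then show ?thesis by (intro exI[of _ "\<Sum>I\<in>UNIV. C (\<alpha> I)"]) (auto simp: C0 intro: sum_nonneg)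
qed

lemma newton_polytope_nonneg: "newton_polytope p \<subseteq> nonneg_orthant"
  unfolding newton_polytope_def
proof (rule hull_minimal)
  show "convex (nonneg_orthant :: (real ^ 'n) set)"
    by (auto simp: convex_def nonneg_orthant_def)
qed (auto simp: nonneg_orthant_def)

text \<open>
  Moving \<open>\<sigma>\<close> by \<open>\<delta>\<close> in the direction of the signs of \<open>t\<close> costs a factor \<open>exp (\<delta> * \<bar>t\<bar>\<^sub>1)\<close> but stays
  inside the dilated polyhedron, where the monomial is dominated by a power of \<open>p\<close> and a monomial
  in the coordinates larger than 1.
\<close>

lemma exp_le_exp_sum_power:
  fixes p :: "'n::finite cpoly" and \<mu> :: "nat \<Rightarrow> nat ^ 'n" and \<nu> :: "nat \<Rightarrow> int"
  assumes Q: "newton_polyhedron p = (\<Inter>k\<in>{1..N}. {\<sigma>. to_real_vec (\<mu> k) \<bullet> \<sigma> \<ge> real_of_int (\<nu> k)})"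
    and \<sigma>: "\<And>k. k \<in> {1..N} \<Longrightarrow> to_real_vec (\<mu> k) \<bullet> \<sigma> > real (Suc m) * real_of_int (\<nu> k)"
  shows "\<exists>\<delta>>0. \<exists>K. \<forall>t. exp (\<sigma> \<bullet> t) \<le>
    (\<Sum>\<alpha>\<in>Poly_Mapping.keys p. exp (to_real_vec \<alpha> \<bullet> t)) ^ Suc m *
    exp (real K * (\<Sum>i\<in>UNIV. max 0 (t $ i))) * exp (- \<delta> * norm t)"
proof -
  define w where "w k = (\<Sum>i\<in>UNIV. real (\<mu> k $ i))" for k
  define gap where "gap k = to_real_vec (\<mu> k) \<bullet> \<sigma> - real (Suc m) * real_of_int (\<nu> k)" for k
  \<comment> \<open>A displacement with entries of size at most \<delta> lowers the k-th linear form
    by at most \<open>\<delta> * w k\<close>, hence by no more than the gap. The 1 in the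
    denominator excludes division by zero, and the inserted 1 keeps the set non-empty for
    \<open>N = 0\<close>.\<close>
  define \<delta> where "\<delta> = Min (insert 1 ((\<lambda>k. gap k / (1 + w k)) ` {1..N}))"
  have w0: "w k \<ge> 0" for k by (simp add: w_def sum_nonneg)
  have gap0: "gap k > 0" if "k \<in> {1..N}" for k using \<sigma>[OF that] by (simp add: gap_def)
  have "\<delta> > 0"
    using w0 gap0 by (auto simp: \<delta>_def intro!: divide_pos_pos add_pos_nonneg)
  have gap_le: "\<delta> * w k \<le> gap k" if "k \<in> {1..N}" for k
  proof -
    have "\<delta> \<le> gap k / (1 + w k)" using that unfolding \<delta>_def by (intro Min_le) auto
    then have "\<delta> * (1 + w k) \<le> gap k" using w0[of k] by (simp add: pos_le_divide_eq)
    then show ?thesis using \<open>\<delta> > 0\<close> by (simp add: algebra_simps)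
  qed
  \<comment> \<open>Since \<open>z\<close> has non-negative entries, those of \<open>Suc m\<close>
    times \<open>r\<close> are at most the entries of \<open>\<sigma> + v\<close>, which this
    integer dominates.\<close>
  define K where "K = nat \<lceil>norm \<sigma> + \<delta>\<rceil>"
  have "exp (\<sigma> \<bullet> t) \<le>
    (\<Sum>\<alpha>\<in>Poly_Mapping.keys p. exp (to_real_vec \<alpha> \<bullet> t)) ^ Suc m *
    exp (real K * (\<Sum>i\<in>UNIV. max 0 (t $ i))) * exp (- \<delta> * norm t)" for t
  proof -
    let ?S = "\<Sum>\<alpha>\<in>Poly_Mapping.keys p. exp (to_real_vec \<alpha> \<bullet> t)"
    define v where "v = (\<chi> i. \<delta> * sgn (t $ i))"
    have v: "\<bar>v $ i\<bar> \<le> \<delta>" for i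
      using \<open>\<delta> > 0\<close> by (simp add: v_def abs_mult abs_sgn_eq)
    have "(1 / real (Suc m)) *\<^sub>R (\<sigma> + v) \<in> newton_polyhedron p"
      unfolding Q
    proof (intro INT_I CollectI)
      fix k assume k: "k \<in> {1..N}"
      have "- (\<delta> * w k) \<le> to_real_vec (\<mu> k) \<bullet> v"
        unfolding w_def inner_vec_def sum_distrib_left sum_negf[symmetric]
      proof (intro sum_mono)
        fix i
        have "real (\<mu> k $ i) * - \<delta> \<le> real (\<mu> k $ i) * v $ i"
          using v[of i] by (intro mult_left_mono) auto
        then show "- (\<delta> * real (\<mu> k $ i)) \<le> to_real_vec (\<mu> k) $ i \<bullet> v $ i" by (simp add: mult.commute)
      qed
      then have "real (Suc m) * real_of_int (\<nu> k) \<le> to_real_vec (\<mu> k) \<bullet> (\<sigma> + v)"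
        using gap_le[OF k] by (simp add: gap_def inner_add_right)
      then show "real_of_int (\<nu> k) \<le> to_real_vec (\<mu> k) \<bullet> ((1 / real (Suc m)) *\<^sub>R (\<sigma> + v))"
        by (simp add: pos_le_divide_eq mult.commute del: of_nat_Suc)
    qed
    then obtain z r where z: "z \<in> newton_polytope p" and r: "r \<in> nonneg_orthant"
      and zr: "(1 / real (Suc m)) *\<^sub>R (\<sigma> + v) = z + r"
      by (auto simp: newton_polyhedron_def set_plus_def)
    have "\<sigma> + v = real (Suc m) *\<^sub>R ((1 / real (Suc m)) *\<^sub>R (\<sigma> + v))" by simp
    then have \<sigma>v: "\<sigma> + v = real (Suc m) *\<^sub>R z + real (Suc m) *\<^sub>R r"
      unfolding zr scaleR_add_right[of _ z r] .
    have z0: "z $ i \<ge> 0" and r0: "r $ i \<ge> 0" for i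
      using z r newton_polytope_nonneg[of p] by (auto simp: nonneg_orthant_def)
    have rK: "real (Suc m) * r $ i \<le> real K" for i
    proof -
      have "\<sigma> $ i + v $ i = real (Suc m) * z $ i + real (Suc m) * r $ i"
        using arg_cong[OF \<sigma>v, of "\<lambda>x. x $ i"] by simp
      moreover have "real (Suc m) * z $ i \<ge> 0" using z0[of i] by simp
      ultimately have "real (Suc m) * r $ i \<le> norm \<sigma> + \<delta>"
        using v[of i] component_le_norm_cart[of \<sigma> i] by linarith
      also have "\<dots> \<le> real K" unfolding K_def by (rule real_nat_ceiling_ge)
      finally show ?thesis .
    qed
    have "z \<bullet> t \<le> ln ?S"
      using inner_le_ln_exp_sum[of "to_real_vec ` Poly_Mapping.keys p" z t] z
        sum.reindex[OF inj_on_subset[OF inj_to_real_vec subset_UNIV], of "\<lambda>v. exp (v \<bullet> t)" "Poly_Mapping.keys p"]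
      by (simp add: newton_polytope_def)
    then have zt: "real (Suc m) * (z \<bullet> t) \<le> real (Suc m) * ln ?S" by (intro mult_left_mono) auto
    have "Poly_Mapping.keys p \<noteq> {}" using z by (auto simp: newton_polytope_def)
    then have S: "?S > 0" by (intro sum_pos) auto
    have rt: "real (Suc m) * (r \<bullet> t) \<le> real K * (\<Sum>i\<in>UNIV. max 0 (t $ i))"
      unfolding inner_vec_def sum_distrib_left
    proof (intro sum_mono)
      fix i
      have "real (Suc m) * r $ i * t $ i \<le> real (Suc m) * r $ i * max 0 (t $ i)"
        using r0[of i] by (intro mult_left_mono) auto
      also have "\<dots> \<le> real K * max 0 (t $ i)" using rK[of i] by (intro mult_right_mono) auto
      finally show "real (Suc m) * (r $ i \<bullet> t $ i) \<le> real K * max 0 (t $ i)" by (simp add: mult.assoc)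
    qed
    have "v \<bullet> t = \<delta> * (\<Sum>i\<in>UNIV. \<bar>t $ i\<bar>)"
      unfolding inner_vec_def sum_distrib_left by (intro sum.cong) (simp_all add: v_def abs_sgn)
    then have vt: "v \<bullet> t \<ge> \<delta> * norm t"
      using norm_le_l1_cart[of t] \<open>\<delta> > 0\<close> by simp
    have "\<sigma> \<bullet> t + v \<bullet> t = real (Suc m) * (z \<bullet> t) + real (Suc m) * (r \<bullet> t)"
      using arg_cong[OF \<sigma>v, of "\<lambda>x. x \<bullet> t"] by (simp add: inner_add_left del: of_nat_Suc)
    then have "\<sigma> \<bullet> t \<le> real (Suc m) * ln ?S + real K * (\<Sum>i\<in>UNIV. max 0 (t $ i)) + - \<delta> * norm t"
      using zt rt vt by linarith
    then have "exp (\<sigma> \<bullet> t) \<le> exp (real (Suc m) * ln ?S + real K * (\<Sum>i\<in>UNIV. max 0 (t $ i)) + - \<delta> * norm t)"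
      by (simp only: exp_le_cancel_iff)
    also have "\<dots> = ?S ^ Suc m * exp (real K * (\<Sum>i\<in>UNIV. max 0 (t $ i))) * exp (- \<delta> * norm t)"
      unfolding exp_add exp_of_nat_mult using S by (simp only: exp_ln)
    finally show ?thesis .
  qed
  then show ?thesis using \<open>\<delta> > 0\<close> by blast
qed

subsection \<open>Integration by parts\<close>

definition cvec :: "nat ^ 'n \<Rightarrow> complex ^ 'n"
  where "cvec \<alpha> = (\<chi> i. of_nat (\<alpha> $ i))"

definition npair :: "nat ^ 'n::finite \<Rightarrow> nat ^ 'n \<Rightarrow> nat"
  where "npair \<mu> \<alpha> = (\<Sum>i\<in>UNIV. \<mu> $ i * \<alpha> $ i)"

lemma cdot_cvec: "cdot (cvec \<alpha>) t = of_real (to_real_vec \<alpha> \<bullet> t)"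
  by (simp add: cdot_def cvec_def inner_vec_def)

lemma cdot_to_real_vec: "cdot s (to_real_vec \<mu>) = pairing \<mu> s"
  by (simp add: cdot_def pairing_def mult.commute)

lemma inner_to_real_vec: "to_real_vec \<alpha> \<bullet> to_real_vec \<mu> = real (npair \<mu> \<alpha>)"
  by (simp add: npair_def inner_vec_def mult.commute)

lemma pairing_add_cvec: "pairing \<mu> (s + cvec \<alpha>) = pairing \<mu> s + of_nat (npair \<mu> \<alpha>)"
  by (simp add: pairing_def npair_def cvec_def distrib_left sum.distrib)

lemma Re_pairing: "Re (pairing \<mu> s) = to_real_vec \<mu> \<bullet> Re_vec s"
  by (simp add: pairing_def Re_vec_def inner_vec_def)

lemma npair_axis: "npair \<mu> (axis i 1) = \<mu> $ i"
  by (simp add: npair_def axis_def if_distrib[of "\<lambda>x. _ * x"] cong: if_cong)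

lemma npair_add: "npair \<mu> (\<alpha> + \<beta>) = npair \<mu> \<alpha> + npair \<mu> \<beta>"
  by (simp add: npair_def distrib_left sum.distrib)

lemma cvec_add: "cvec (\<alpha> + \<beta>) = cvec \<alpha> + cvec \<beta>"
  by (simp add: cvec_def vec_eq_iff)

lemma cvec_0 [simp]: "cvec 0 = 0"
  by (simp add: cvec_def vec_eq_iff)

lemma npair_0 [simp]: "npair \<mu> 0 = 0"
  by (simp add: npair_def)

text \<open>\<open>D\<close> is the whole family of partial derivatives of \<phi>, fixed once,
  because integration by parts generates terms with every index \<beta>.\<close>

locale mellin_setup =
  fixes p :: "'n::finite cpoly" and D :: "nat ^ 'n \<Rightarrow> real ^ 'n \<Rightarrow> complex"
    and N :: nat and \<mu> :: "nat \<Rightarrow> nat ^ 'n" and \<nu> :: "nat \<Rightarrow> int"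
  assumes nonvanishing: "completely_nonvanishing_on p pos_orthant"
    and deriv: "\<And>\<beta> x. x \<in> nonneg_orthant \<Longrightarrow> (D \<beta> has_derivative
        (\<lambda>h. \<Sum>i\<in>UNIV. complex_of_real (h $ i) * D (\<beta> + axis i 1) x)) (at x within nonneg_orthant)"
    and decay: "\<And>\<alpha> \<beta>. ((\<lambda>x. complex_of_real (monom_at \<alpha> x) * D \<beta> x) \<longlongrightarrow> 0)
       (inf at_infinity (principal nonneg_orthant))"
    and polyhedron: "newton_polyhedron p =
      (\<Inter>k\<in>{1..N}. {\<sigma>. to_real_vec (\<mu> k) \<bullet> \<sigma> \<ge> real_of_int (\<nu> k)})"
begin

definition P :: "real ^ 'n \<Rightarrow> complex"
  where "P t = poly_at p (exp_vec t)"

text \<open>With \<beta> = 0 and m = 0 this is the original \<phi> / p, whence the power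
  \<open>Suc m\<close>. No Jacobian appears because d\<epsilon> / \<epsilon> becomes Lebesgue
  measure in t.\<close>

definition g :: "nat ^ 'n \<Rightarrow> nat \<Rightarrow> real ^ 'n \<Rightarrow> complex"
  where "g \<beta> m t = D \<beta> (exp_vec t) / P t ^ Suc m"

definition J :: "nat ^ 'n \<Rightarrow> nat \<Rightarrow> complex ^ 'n \<Rightarrow> complex"
  where "J \<beta> m s = (\<integral>t. exp (cdot s t) * g \<beta> m t \<partial>lborel)"

definition conv_region :: "nat \<Rightarrow> (complex ^ 'n) set"
  where "conv_region m =
    {s. \<forall>k\<in>{1..N}. Re (pairing (\<mu> k) s) > real (Suc m) * real_of_int (\<nu> k)}"

lemma P_nonzero: "P t \<noteq> 0"
  using nonvanishing exp_vec_pos[of t] by (auto simp: P_def completely_nonvanishing_on_def)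

lemma P_eq: "P t = (\<Sum>\<alpha>\<in>Poly_Mapping.keys p. Poly_Mapping.lookup p \<alpha> * exp (cdot (cvec \<alpha>) t))"
  by (simp add: P_def poly_at_def monom_at_exp_vec cdot_cvec exp_of_real)

lemma has_derivative_cdot: "((\<lambda>t. cdot s t) has_derivative (\<lambda>h. cdot s h)) (at t)"
  unfolding cdot_def
  by (intro bounded_linear_imp_has_derivative bounded_linear_sum bounded_linear_const_mult
      bounded_linear_compose[OF bounded_linear_of_real bounded_linear_vec_nth])

lemma has_derivative_exp_cdot:
  "((\<lambda>t. exp (cdot s t)) has_derivative (\<lambda>h. exp (cdot s t) * cdot s h)) (at t)"
  using has_derivative_compose[OF has_derivative_cdot DERIV_exp[unfolded has_field_derivative_def]] .

lemma has_derivative_P: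
  "(P has_derivative (\<lambda>h. \<Sum>\<alpha>\<in>Poly_Mapping.keys p.
      Poly_Mapping.lookup p \<alpha> * (exp (cdot (cvec \<alpha>) t) * cdot (cvec \<alpha>) h))) (at t)"
  unfolding P_eq[abs_def]
  by (intro has_derivative_sum has_derivative_mult_right has_derivative_exp_cdot)

lemma has_derivative_exp_vec:
  "(exp_vec has_derivative (\<lambda>h. \<chi> i. exp (t $ i) * h $ i)) (at (t :: real ^ 'n))"
proof (subst has_derivative_componentwise_within, intro ballI)
  fix b :: "real ^ 'n" assume "b \<in> Basis"
  then obtain i where b: "b = axis i 1" by (auto simp: Basis_vec_def)
  have "((\<lambda>t::real^'n. exp (t $ i)) has_derivative (\<lambda>h. exp (t $ i) * h $ i)) (at t)"
    by (auto intro!: derivative_eq_intros bounded_linear.has_derivative[OF bounded_linear_vec_nth])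
  then show "((\<lambda>x. exp_vec x \<bullet> b) has_derivative (\<lambda>x. (\<chi> i. exp (t $ i) * x $ i) \<bullet> b)) (at t)"
    by (simp add: b inner_axis)
qed

text \<open>The chain-rule factor, the exponential of the i-th coordinate, is written through
  \<open>cdot\<close> so that it can later be merged into a shift of \<open>s\<close> by a unit
  vector.\<close>

lemma has_derivative_D_exp_vec:
  "((\<lambda>t. D \<beta> (exp_vec t)) has_derivative
    (\<lambda>h. \<Sum>i\<in>UNIV. complex_of_real (h $ i) * (exp (cdot (cvec (axis i 1)) t) * D (\<beta> + axis i 1) (exp_vec t)))) (at t)"
proof -
  \<comment> \<open>On the open orthant the one-sided derivative becomes an ordinary one, and
    \<open>exp_vec\<close> takes values only there.\<close>
  have "pos_orthant \<subseteq> (nonneg_orthant :: (real ^ 'n) set)"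
    by (auto simp: pos_orthant_def nonneg_orthant_def less_imp_le)
  then have "(D \<beta> has_derivative (\<lambda>h. \<Sum>i\<in>UNIV. complex_of_real (h $ i) * D (\<beta> + axis i 1) (exp_vec t)))
      (at (exp_vec t) within pos_orthant)"
    using deriv[OF exp_vec_nonneg] has_derivative_subset by blast
  then have D: "(D \<beta> has_derivative (\<lambda>h. \<Sum>i\<in>UNIV. complex_of_real (h $ i) * D (\<beta> + axis i 1) (exp_vec t)))
      (at (exp_vec t))"
    using at_within_open[OF exp_vec_pos open_pos_orthant, of t] by simp
  have ax: "exp (cdot (cvec (axis i 1)) t) = complex_of_real (exp (t $ i))" for i
  proof -
    have "to_real_vec (axis i 1) = axis i (1::real)"
      by (simp add: vec_eq_iff axis_def)
    then show ?thesis by (simp add: cdot_cvec exp_of_real inner_axis' )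
  qed
  show ?thesis
    unfolding ax using has_derivative_compose[OF has_derivative_exp_vec D]
    by (rule has_derivative_eq_rhs) (simp add: fun_eq_iff mult_ac)
qed

lemma continuous_exp_cdot_g: "continuous_on UNIV (\<lambda>t. exp (cdot s t) * g \<beta> m t)"
proof -
  have "continuous_on UNIV P"
    using has_derivative_P by (intro continuous_at_imp_continuous_on ballI has_derivative_continuous)
  moreover have "continuous_on UNIV (\<lambda>t. D \<beta> (exp_vec t))"
    using has_derivative_D_exp_vec by (intro continuous_at_imp_continuous_on ballI has_derivative_continuous)
  ultimately show ?thesis
    unfolding g_def by (intro continuous_intros) (use P_nonzero in auto)
qed

lemma measurable_exp_cdot_g [measurable]: "(\<lambda>t. exp (cdot s t) * g \<beta> m t) \<in> borel_measurable borel"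
  by (rule borel_measurable_continuous_onI[OF continuous_exp_cdot_g])

lemma measurable_g: "g \<beta> m \<in> borel_measurable borel"
  using measurable_exp_cdot_g[of 0 \<beta> m] by (simp add: cdot_def)

text \<open>The power of the monomial sum in \<open>exp_le_exp_sum_power\<close> cancels against the
  lower bound for \<open>P\<close>, and the exponential growth in the positive parts of
  \<open>t\<close> is absorbed by the rapid decay of \<open>D \<beta>\<close>. The remaining factor
  is the decay.\<close>

lemma exp_decay_integrand:
  assumes "s \<in> conv_region m"
  shows "exp_decay (\<lambda>t. exp (cdot s t) * g \<beta> m t)"
proof -
  let ?S = "\<lambda>t. \<Sum>\<alpha>\<in>Poly_Mapping.keys p. exp (to_real_vec \<alpha> \<bullet> t)"
  obtain c where c: "c > 0" "\<And>t. c * ?S t \<le> norm (P t)"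
    using completely_nonvanishing_lower_bound[OF nonvanishing] by (auto simp: P_def)
  obtain \<delta> K where \<delta>: "\<delta> > 0" and K: "\<And>t. exp (Re_vec s \<bullet> t) \<le>
      ?S t ^ Suc m * exp (real K * (\<Sum>i\<in>UNIV. max 0 (t $ i))) * exp (- \<delta> * norm t)"
    using exp_le_exp_sum_power[OF polyhedron, of m "Re_vec s"] assms
    by (auto simp: conv_region_def Re_pairing simp del: of_nat_Suc)
  have "continuous_on nonneg_orthant (D \<beta>)"
    by (auto simp: continuous_on_eq_continuous_within intro: has_derivative_continuous[OF deriv])
  then obtain C where C: "C \<ge> 0" "\<And>t. norm (D \<beta> (exp_vec t)) * exp (real K * (\<Sum>i\<in>UNIV. max 0 (t $ i))) \<le> C"
    using rapid_decay_exp_vec[of "D \<beta>" K] decay by blast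
  have "norm (exp (cdot s t) * g \<beta> m t) \<le> (C / c ^ Suc m) * exp (- \<delta> * norm t)" for t
  proof -
    have S: "?S t > 0"
    proof -
      have "P t \<noteq> 0" by (rule P_nonzero)
      then have "Poly_Mapping.keys p \<noteq> {}" by (auto simp: P_def poly_at_def)
      then show ?thesis by (intro sum_pos) auto
    qed
    have "norm (exp (cdot s t) * g \<beta> m t) = exp (Re_vec s \<bullet> t) * norm (D \<beta> (exp_vec t)) / norm (P t) ^ Suc m"
      by (simp only: norm_mult norm_divide norm_power norm_exp_cdot g_def times_divide_eq_right)
    also have "\<dots> \<le> exp (Re_vec s \<bullet> t) * norm (D \<beta> (exp_vec t)) / (c * ?S t) ^ Suc m"
      using c(1) S by (intro divide_left_mono power_mono c(2) mult_nonneg_nonneg mult_pos_pos zero_less_power)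
        (auto simp: P_nonzero)
    also have "\<dots> \<le> (?S t ^ Suc m * exp (real K * (\<Sum>i\<in>UNIV. max 0 (t $ i))) * exp (- \<delta> * norm t))
        * norm (D \<beta> (exp_vec t)) / (c * ?S t) ^ Suc m"
      using c(1) S by (intro divide_right_mono mult_right_mono K) auto
    also have "\<dots> = (norm (D \<beta> (exp_vec t)) * exp (real K * (\<Sum>i\<in>UNIV. max 0 (t $ i)))) / c ^ Suc m * exp (- \<delta> * norm t)"
      using S c(1) by (simp only: power_mult_distrib) (simp add: field_simps del: power_Suc)
    also have "\<dots> \<le> C / c ^ Suc m * exp (- \<delta> * norm t)"
      using c(1) by (intro mult_right_mono divide_right_mono C(2)) auto
    finally show ?thesis .
  qed
  then show ?thesis using \<delta> by (rule exp_decayI[rotated])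
qed

lemma integrable_integrand:
  "s \<in> conv_region m \<Longrightarrow> integrable lborel (\<lambda>t. exp (cdot s t) * g \<beta> m t)"
  by (intro exp_decay_integrable exp_decay_integrand) simp_all

lemma holomorphic_J:
  assumes "s \<in> conv_region m"
  shows "holomorphic_Cn_at (J \<beta> m) s"
  unfolding holomorphic_Cn_at_def J_def[abs_def]
  by (rule exI, rule has_derivative_exp_transform[OF measurable_g exp_decay_integrand[OF assms]])

lemma exponent_in_polyhedron:
  assumes "\<alpha> \<in> Poly_Mapping.keys p" "k \<in> {1..N}"
  shows "\<nu> k \<le> int (npair (\<mu> k) \<alpha>)"
proof -
  have "to_real_vec \<alpha> \<in> newton_polytope p"
    using assms(1) by (simp add: newton_polytope_def hull_inc)
  then have "to_real_vec \<alpha> + 0 \<in> newton_polyhedron p"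
    unfolding newton_polyhedron_def by (intro set_plus_intro) (auto simp: nonneg_orthant_def)
  then have "real_of_int (\<nu> k) \<le> to_real_vec (\<mu> k) \<bullet> to_real_vec \<alpha>"
    using assms(2) by (auto simp: polyhedron)
  also have "\<dots> = real (npair (\<mu> k) \<alpha>)" by (simp add: inner_to_real_vec inner_commute)
  finally show ?thesis by linarith
qed

lemma conv_region_add_cvec:
  assumes "s \<in> conv_region m"
  shows "s + cvec \<alpha> \<in> conv_region m"
  using assms by (force simp: conv_region_def pairing_add_cvec simp del: of_nat_Suc)

text \<open>A monomial of p in the numerator pays for one more power of p in the
  denominator.\<close>

lemma conv_region_add_exponent:
  assumes "s \<in> conv_region m" "\<alpha> \<in> Poly_Mapping.keys p"
  shows "s + cvec \<alpha> \<in> conv_region (Suc m)"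
  unfolding conv_region_def
proof (intro CollectI ballI)
  fix k assume k: "k \<in> {1..N}"
  have "real_of_int (\<nu> k) \<le> real (npair (\<mu> k) \<alpha>)"
    using exponent_in_polyhedron[OF assms(2) k] by linarith
  moreover have "real (Suc m) * real_of_int (\<nu> k) < Re (pairing (\<mu> k) s)"
    using assms(1) k by (simp add: conv_region_def)
  ultimately show "real (Suc (Suc m)) * real_of_int (\<nu> k) < Re (pairing (\<mu> k) (s + cvec \<alpha>))"
    by (simp add: pairing_add_cvec algebra_simps)
qed

text \<open>The product rule along \<kappa>, with derivatives falling on the exponential, on
  \<open>D \<beta>\<close> and on the power of \<open>P\<close>. Every new exponential is merged
  into the exponent, so the result is again a combination of integrands of the same type.\<close>

lemma has_vector_derivative_integrand:
  "((\<lambda>\<tau>. exp (cdot s (t + \<tau> *\<^sub>R to_real_vec \<kappa>)) * g \<beta> m (t + \<tau> *\<^sub>R to_real_vec \<kappa>)) has_vector_derivative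
    (pairing \<kappa> s * (exp (cdot s t) * g \<beta> m t)
     + (\<Sum>i\<in>UNIV. of_nat (\<kappa> $ i) * (exp (cdot (s + cvec (axis i 1)) t) * g (\<beta> + axis i 1) m t))
     - of_nat (Suc m) * (\<Sum>\<alpha>\<in>Poly_Mapping.keys p. Poly_Mapping.lookup p \<alpha> * of_nat (npair \<kappa> \<alpha>) *
         (exp (cdot (s + cvec \<alpha>) t) * g \<beta> (Suc m) t)))) (at 0)"
proof -
  let ?v = "to_real_vec \<kappa>"
  let ?K = "Poly_Mapping.keys p" and ?a = "Poly_Mapping.lookup p"
  have line: "((\<lambda>\<tau>. t + \<tau> *\<^sub>R ?v) has_derivative (\<lambda>r. r *\<^sub>R ?v)) (at 0)"
    by (auto intro!: derivative_eq_intros)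
  have along: "((\<lambda>\<tau>. F (t + \<tau> *\<^sub>R ?v)) has_vector_derivative F' ?v) (at 0)"
    if "(F has_derivative F') (at t)" for F :: "real ^ 'n \<Rightarrow> complex" and F'
  proof -
    have "((\<lambda>\<tau>. F (t + \<tau> *\<^sub>R ?v)) has_derivative (\<lambda>r. F' (r *\<^sub>R ?v))) (at 0)"
      using has_derivative_compose[OF line] that by simp
    moreover have "F' (r *\<^sub>R ?v) = r *\<^sub>R F' ?v" for r
      using that by (simp add: has_derivative_bounded_linear bounded_linear.linear linear_cmul)
    ultimately show ?thesis by (simp add: has_vector_derivative_def)
  qed
  define dD where "dD = (\<Sum>i\<in>UNIV. of_nat (\<kappa> $ i) * (exp (cdot (cvec (axis i 1)) t) * D (\<beta> + axis i 1) (exp_vec t)))"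
  define dP where "dP = (\<Sum>\<alpha>\<in>?K. ?a \<alpha> * (exp (cdot (cvec \<alpha>) t) * of_nat (npair \<kappa> \<alpha>)))"
  have 1: "((\<lambda>\<tau>. exp (cdot s (t + \<tau> *\<^sub>R ?v))) has_vector_derivative exp (cdot s t) * pairing \<kappa> s) (at 0)"
    using along[OF has_derivative_exp_cdot] by (simp add: cdot_to_real_vec)
  have 2: "((\<lambda>\<tau>. D \<beta> (exp_vec (t + \<tau> *\<^sub>R ?v))) has_vector_derivative dD) (at 0)"
    using along[OF has_derivative_D_exp_vec] by (simp add: dD_def)
  have 3: "((\<lambda>\<tau>. P (t + \<tau> *\<^sub>R ?v)) has_vector_derivative dP) (at 0)"
    using along[OF has_derivative_P] by (simp add: dP_def cdot_cvec[of _ ?v] inner_to_real_vec)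
  have 4: "((\<lambda>\<tau>. inverse (P (t + \<tau> *\<^sub>R ?v) ^ Suc m)) has_vector_derivative
      dP * (- of_nat (Suc m) * inverse (P t ^ Suc (Suc m)))) (at 0)"
  proof -
    let ?z = "P (t + 0 *\<^sub>R ?v)"
    have z: "?z \<noteq> 0" by (rule P_nonzero)
    have "((\<lambda>z. inverse (z ^ Suc m)) has_field_derivative
        - ((1 + of_nat m) * (1 * ?z ^ m) * inverse ((?z ^ Suc m) ^ Suc (Suc 0)))) (at ?z)"
      using z by (intro DERIV_inverse_fun DERIV_power_Suc DERIV_ident) simp
    moreover have "- ((1 + of_nat m) * (1 * ?z ^ m) * inverse ((?z ^ Suc m) ^ Suc (Suc 0)))
        = - of_nat (Suc m) * inverse (P t ^ Suc (Suc m))"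
      using P_nonzero[of t] by (simp add: field_simps)
    ultimately have "((\<lambda>z. inverse (z ^ Suc m)) has_field_derivative (- of_nat (Suc m) * inverse (P t ^ Suc (Suc m))))
        (at ?z)"
      by (simp only:)
    from field_vector_diff_chain_at[OF 3 this] show ?thesis by (simp add: o_def)
  qed
  have E: "exp (cdot (s + s') t) = exp (cdot s t) * exp (cdot s' t)" for s'
    by (simp add: cdot_add_left exp_add)
  have "((\<lambda>\<tau>. exp (cdot s (t + \<tau> *\<^sub>R ?v)) * (D \<beta> (exp_vec (t + \<tau> *\<^sub>R ?v)) * inverse (P (t + \<tau> *\<^sub>R ?v) ^ Suc m)))
      has_vector_derivative
      exp (cdot s (t + 0 *\<^sub>R ?v)) * (D \<beta> (exp_vec (t + 0 *\<^sub>R ?v)) * (dP * (- of_nat (Suc m) * inverse (P t ^ Suc (Suc m))))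
         + dD * inverse (P (t + 0 *\<^sub>R ?v) ^ Suc m))
      + (exp (cdot s t) * pairing \<kappa> s) * (D \<beta> (exp_vec (t + 0 *\<^sub>R ?v)) * inverse (P (t + 0 *\<^sub>R ?v) ^ Suc m))) (at 0)"
    by (intro has_vector_derivative_mult 1 2 4)
  then have *: "((\<lambda>\<tau>. exp (cdot s (t + \<tau> *\<^sub>R ?v)) * g \<beta> m (t + \<tau> *\<^sub>R ?v)) has_vector_derivative
      exp (cdot s t) * (D \<beta> (exp_vec t) * (dP * (- of_nat (Suc m) * inverse (P t ^ Suc (Suc m))))
         + dD * inverse (P t ^ Suc m))
      + (exp (cdot s t) * pairing \<kappa> s) * g \<beta> m t) (at 0)"
    by (simp only: g_def divide_inverse scaleR_zero_left add_0_right)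
  have A: "exp (cdot s t) * (dD * inverse (P t ^ Suc m)) =
      (\<Sum>i\<in>UNIV. of_nat (\<kappa> $ i) * (exp (cdot (s + cvec (axis i 1)) t) * g (\<beta> + axis i 1) m t))"
    unfolding dD_def sum_distrib_right sum_distrib_left
    by (intro sum.cong refl) (simp only: E g_def divide_inverse mult_ac)
  have B: "exp (cdot s t) * (D \<beta> (exp_vec t) * (dP * inverse (P t ^ Suc (Suc m)))) =
      (\<Sum>\<alpha>\<in>?K. ?a \<alpha> * of_nat (npair \<kappa> \<alpha>) * (exp (cdot (s + cvec \<alpha>) t) * g \<beta> (Suc m) t))"
    unfolding dP_def sum_distrib_right sum_distrib_left
    by (intro sum.cong refl) (simp only: E g_def divide_inverse mult_ac)
  have "exp (cdot s t) * (D \<beta> (exp_vec t) * (dP * (- of_nat (Suc m) * inverse (P t ^ Suc (Suc m))))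
         + dD * inverse (P t ^ Suc m)) + (exp (cdot s t) * pairing \<kappa> s) * g \<beta> m t
      = pairing \<kappa> s * (exp (cdot s t) * g \<beta> m t)
        + exp (cdot s t) * (dD * inverse (P t ^ Suc m))
        - of_nat (Suc m) * (exp (cdot s t) * (D \<beta> (exp_vec t) * (dP * inverse (P t ^ Suc (Suc m)))))"
    by (simp add: algebra_simps del: power_Suc of_nat_Suc)
  with * show ?thesis by (simp only: A B)
qed

text \<open>The integral of the derivative along \<kappa> vanishes. Expanding one factor of
  \<open>P / P\<close> writes \<open>J \<beta> m s\<close> through the same integrals as the last
  sum, and subtracting the multiple \<open>Suc m * \<nu>0\<close> of that identity turns the
  coefficient \<open>npair \<kappa> \<alpha>\<close> into its difference from \<open>\<nu>0\<close>,
  which is 0 for exponents on the hyperplane of value \<open>\<nu>0\<close>.\<close>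

lemma integration_by_parts:
  assumes s: "s \<in> conv_region m"
  shows "(pairing \<kappa> s - of_nat (Suc m) * of_int \<nu>0) * J \<beta> m s =
    - (\<Sum>i\<in>UNIV. of_nat (\<kappa> $ i) * J (\<beta> + axis i 1) m (s + cvec (axis i 1)))
    + of_nat (Suc m) * (\<Sum>\<alpha>\<in>Poly_Mapping.keys p.
        Poly_Mapping.lookup p \<alpha> * (of_nat (npair \<kappa> \<alpha>) - of_int \<nu>0) * J \<beta> (Suc m) (s + cvec \<alpha>))"
proof -
  let ?K = "Poly_Mapping.keys p" and ?a = "Poly_Mapping.lookup p"
  let ?f = "\<lambda>\<beta> m s t. exp (cdot s t) * g \<beta> m t"
  let ?f' = "\<lambda>t. pairing \<kappa> s * ?f \<beta> m s t
     + (\<Sum>i\<in>UNIV. of_nat (\<kappa> $ i) * ?f (\<beta> + axis i 1) m (s + cvec (axis i 1)) t)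
     - of_nat (Suc m) * (\<Sum>\<alpha>\<in>?K. ?a \<alpha> * of_nat (npair \<kappa> \<alpha>) * ?f \<beta> (Suc m) (s + cvec \<alpha>) t)"
  note int = integrable_integrand[OF s] integrable_integrand[OF conv_region_add_cvec[OF s]]
    integrable_integrand[OF conv_region_add_exponent[OF s]]
  have int': "integrable lborel ?f'"
    by (intro Bochner_Integration.integrable_diff Bochner_Integration.integrable_add
        Bochner_Integration.integrable_sum integrable_mult_right int)
  have "integral\<^sup>L lborel ?f' = 0"
    by (rule integral_directional_derivative_eq_0[OF has_vector_derivative_integrand[of s _ \<kappa> \<beta> m] _ int(1) int'])
      (intro continuous_intros continuous_exp_cdot_g)
  moreover have "integral\<^sup>L lborel ?f' = pairing \<kappa> s * J \<beta> m s
     + (\<Sum>i\<in>UNIV. of_nat (\<kappa> $ i) * J (\<beta> + axis i 1) m (s + cvec (axis i 1)))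
     - of_nat (Suc m) * (\<Sum>\<alpha>\<in>?K. ?a \<alpha> * of_nat (npair \<kappa> \<alpha>) * J \<beta> (Suc m) (s + cvec \<alpha>))"
    unfolding J_def using int by (simp del: of_nat_Suc)
  moreover have "J \<beta> m s = (\<Sum>\<alpha>\<in>?K. ?a \<alpha> * J \<beta> (Suc m) (s + cvec \<alpha>))"
  proof -
    have "?f \<beta> m s t = (\<Sum>\<alpha>\<in>?K. ?a \<alpha> * ?f \<beta> (Suc m) (s + cvec \<alpha>) t)" for t
    proof -
      have "(\<Sum>\<alpha>\<in>?K. ?a \<alpha> * ?f \<beta> (Suc m) (s + cvec \<alpha>) t) = exp (cdot s t) * (P t * g \<beta> (Suc m) t)"
        unfolding P_eq sum_distrib_right sum_distrib_left
        by (intro sum.cong) (simp_all add: cdot_add_left exp_add)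
      also have "P t * g \<beta> (Suc m) t = g \<beta> m t" using P_nonzero[of t] by (simp add: g_def)
      finally show ?thesis by (rule sym)
    qed
    then have "J \<beta> m s = (\<integral>t. (\<Sum>\<alpha>\<in>?K. ?a \<alpha> * ?f \<beta> (Suc m) (s + cvec \<alpha>) t) \<partial>lborel)"
      unfolding J_def by simp
    also have "\<dots> = (\<Sum>\<alpha>\<in>?K. ?a \<alpha> * J \<beta> (Suc m) (s + cvec \<alpha>))"
      unfolding J_def using int by simp
    finally show ?thesis .
  qed
  then have "of_int \<nu>0 * J \<beta> m s = (\<Sum>\<alpha>\<in>?K. ?a \<alpha> * of_int \<nu>0 * J \<beta> (Suc m) (s + cvec \<alpha>))"
    by (simp add: sum_distrib_left mult_ac)
  moreover have "(\<Sum>\<alpha>\<in>?K. ?a \<alpha> * (of_nat (npair \<kappa> \<alpha>) - of_int \<nu>0) * J \<beta> (Suc m) (s + cvec \<alpha>)) =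
      (\<Sum>\<alpha>\<in>?K. ?a \<alpha> * of_nat (npair \<kappa> \<alpha>) * J \<beta> (Suc m) (s + cvec \<alpha>))
      - (\<Sum>\<alpha>\<in>?K. ?a \<alpha> * of_int \<nu>0 * J \<beta> (Suc m) (s + cvec \<alpha>))"
    by (simp add: algebra_simps sum_subtractf)
  \<comment> \<open>The elimination is stated for plain complex variables so that
    \<open>algebra\<close> treats the integrals as atoms.\<close>
  moreover have "(q - c * v) * I = - X + c * W"
    if "I' = 0" "I' = q * I + X - c * Y" "v * I = Z" "W = Y - Z" for q c v I X Y Z W I' :: complex
    using that by algebra
  ultimately show ?thesis by blast
qed

end

subsection \<open>Continuation\<close>

context mellin_setup
begin

definition facet_form :: "nat \<Rightarrow> complex ^ 'n \<Rightarrow> complex"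
  where "facet_form k s = pairing (\<mu> k) s - of_int (\<nu> k)"

text \<open>Each facet has its own depth because the facets are crossed one at a time.\<close>

definition region :: "(nat \<Rightarrow> nat) \<Rightarrow> (complex ^ 'n) set"
  where "region l = {s. \<forall>k\<in>{1..N}. Re (facet_form k s) > - real (l k)}"

text \<open>
  \<open>depth_regular l\<close> consists of combinations, with entire coefficients, of shifted integrals that all
  converge on \<open>region l\<close>.
\<close>

inductive depth_regular :: "(nat \<Rightarrow> nat) \<Rightarrow> (complex ^ 'n \<Rightarrow> complex) \<Rightarrow> bool" for l where
  basic: "(\<And>k. k \<in> {1..N} \<Longrightarrow> int (l k) \<le> int (npair (\<mu> k) a) - int m * \<nu> k) \<Longrightarrow>
    depth_regular l (\<lambda>s. J \<beta> m (s + cvec a))"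
| zero: "depth_regular l (\<lambda>_. 0)"
| add: "depth_regular l F \<Longrightarrow> depth_regular l G \<Longrightarrow> depth_regular l (\<lambda>s. F s + G s)"
| mult: "(\<And>s. holomorphic_Cn_at c s) \<Longrightarrow> depth_regular l F \<Longrightarrow> depth_regular l (\<lambda>s. c s * F s)"

lemma depth_regular_cmult: "depth_regular l F \<Longrightarrow> depth_regular l (\<lambda>s. c * F s)"
  by (rule depth_regular.mult[OF holomorphic_Cn_at_const])

lemma depth_regular_sum: "(\<And>j. j \<in> A \<Longrightarrow> depth_regular l (F j)) \<Longrightarrow> depth_regular l (\<lambda>s. \<Sum>j\<in>A. F j s)"
proof (induction A rule: infinite_finite_induct)
  case (insert j A)
  then have "depth_regular l (\<lambda>s. F j s + (\<Sum>j\<in>A. F j s))" by (intro depth_regular.add) simp_all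
  then show ?case using insert by simp
qed (simp_all add: depth_regular.zero)

lemma depth_regular_antimono:
  assumes "depth_regular l F" "\<And>k. k \<in> {1..N} \<Longrightarrow> l' k \<le> l k"
  shows "depth_regular l' F"
  using assms(1)
proof induction
  case (basic a m \<beta>)
  show ?case
  proof (rule depth_regular.basic)
    fix k assume "k \<in> {1..N}"
    then show "int (l' k) \<le> int (npair (\<mu> k) a) - int m * \<nu> k"
      using basic[of k] assms(2)[of k] by linarith
  qed
qed (rule depth_regular.zero depth_regular.add depth_regular.mult; assumption)+

text \<open>The depth inequality makes up the difference between Re z_k > - l k and the strict
  inequality that convergence with power \<open>Suc m\<close> demands at the shifted point.\<close>

lemma region_shift:
  assumes "s \<in> region l" "\<And>k. k \<in> {1..N} \<Longrightarrow> int (l k) \<le> int (npair (\<mu> k) a) - int m * \<nu> k"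
  shows "s + cvec a \<in> conv_region m"
  unfolding conv_region_def
proof (intro CollectI ballI)
  fix k assume k: "k \<in> {1..N}"
  have "real (l k) \<le> real (npair (\<mu> k) a) - real m * real_of_int (\<nu> k)"
    using iffD2[OF of_int_le_iff[where ?'a = real] assms(2)[OF k]] by simp
  moreover have "Re (pairing (\<mu> k) s) - real_of_int (\<nu> k) > - real (l k)"
    using assms(1) k by (simp add: region_def facet_form_def)
  ultimately show "real (Suc m) * real_of_int (\<nu> k) < Re (pairing (\<mu> k) (s + cvec a))"
    by (simp add: pairing_add_cvec algebra_simps)
qed

lemma depth_regular_holomorphic:
  assumes "depth_regular l F" "s \<in> region l"
  shows "holomorphic_Cn_at F s"
  using assms(1)
proof induction
  case (basic a m \<beta>)
  then show ?case
    by (intro holomorphic_Cn_at_shift holomorphic_J region_shift[OF assms(2)])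
next
  case zero
  show ?case by (rule holomorphic_Cn_at_const)
next
  case (add F G)
  then show ?case by (intro holomorphic_Cn_at_add)
next
  case (mult c F)
  then show ?case by (intro holomorphic_Cn_at_mult)
qed

lemma holomorphic_facet_form [holomorphic_Cn_intros]: "holomorphic_Cn_at (facet_form k) s"
proof -
  have "holomorphic_Cn_at (\<lambda>s. pairing (\<mu> k) s + - of_int (\<nu> k)) s"
    by (intro holomorphic_Cn_intros)
  then show ?thesis by (simp add: facet_form_def[abs_def])
qed

text \<open>
  A term whose depth in direction \<open>j\<close> is exactly \<open>l j\<close> is improved by integrating by parts along
  \<open>\<mu> j\<close>: the exponents of \<open>p\<close> on the facet \<open>j\<close> drop out and all other terms gain depth.
\<close>

lemma depth_regular_step_term:
  assumes j: "j \<in> {1..N}"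
    and l: "\<And>k. k \<in> {1..N} \<Longrightarrow> int (l k) \<le> int (npair (\<mu> k) a) - int m * \<nu> k"
    and lj: "int (l j) = int (npair (\<mu> j) a) - int m * \<nu> j"
  shows "\<exists>G. depth_regular (l(j := Suc (l j))) G \<and>
    (\<forall>s\<in>region l. G s = (facet_form j s + of_nat (l j)) * J \<beta> m (s + cvec a))"
proof -
  let ?l = "l(j := Suc (l j))"
  \<comment> \<open>The right-hand side of \<open>integration_by_parts\<close> at
    \<open>s + cvec a\<close>, with \<open>\<kappa> = \<mu> j\<close> and
    \<open>\<nu>0 = \<nu> j\<close>.\<close>
  define G where "G s = (- 1) * (\<Sum>i\<in>UNIV. of_nat (\<mu> j $ i) * J (\<beta> + axis i 1) m (s + cvec (a + axis i 1)))
    + of_nat (Suc m) * (\<Sum>\<alpha>\<in>Poly_Mapping.keys p.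
        (Poly_Mapping.lookup p \<alpha> * (of_nat (npair (\<mu> j) \<alpha>) - of_int (\<nu> j))) * J \<beta> (Suc m) (s + cvec (a + \<alpha>)))" for s
  have "depth_regular ?l (\<lambda>s. of_nat (\<mu> j $ i) * J (\<beta> + axis i 1) m (s + cvec (a + axis i 1)))" for i
  \<comment> \<open>Either the coefficient vanishes, or the unit shift raises the depth across facet
    j by \<open>\<mu> j $ i\<close>, which is at least 1.\<close>
  proof (cases "\<mu> j $ i = 0")
    case True
    then show ?thesis by (simp add: depth_regular.zero)
  next
    case False
    show ?thesis
    proof (intro depth_regular_cmult depth_regular.basic)
      fix k assume "k \<in> {1..N}"
      then show "int (?l k) \<le> int (npair (\<mu> k) (a + axis i 1)) - int m * \<nu> k"
        using l[of k] False by (auto simp: npair_add npair_axis[unfolded One_nat_def])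
    qed
  qed
  moreover have "depth_regular ?l (\<lambda>s. (Poly_Mapping.lookup p \<alpha> * (of_nat (npair (\<mu> j) \<alpha>) - of_int (\<nu> j))) * J \<beta> (Suc m) (s + cvec (a + \<alpha>)))"
    if \<alpha>: "\<alpha> \<in> Poly_Mapping.keys p" for \<alpha>
  proof (cases "int (npair (\<mu> j) \<alpha>) = \<nu> j")
    case True
    then have "of_nat (npair (\<mu> j) \<alpha>) = (of_int (\<nu> j) :: complex)" by (metis of_int_of_nat_eq)
    then show ?thesis by (simp add: depth_regular.zero)
  next
    \<comment> \<open>Depths are integers: an exponent of p off the facet raises the depth across it
      by at least 1 even after the extra power of p is paid for.\<close>
    case False
    show ?thesis
    proof (intro depth_regular_cmult depth_regular.basic)
      fix k assume "k \<in> {1..N}"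
      then show "int (?l k) \<le> int (npair (\<mu> k) (a + \<alpha>)) - int (Suc m) * \<nu> k"
        using l[of k] False exponent_in_polyhedron[OF \<alpha>, of k] by (auto simp: npair_add algebra_simps)
    qed
  qed
  ultimately have "depth_regular ?l G"
    unfolding G_def by (intro depth_regular.add depth_regular_cmult[OF depth_regular_sum])
  moreover have "G s = (facet_form j s + of_nat (l j)) * J \<beta> m (s + cvec a)" if s: "s \<in> region l" for s
  proof -
    \<comment> \<open>By \<open>lj\<close> the depth is exactly \<open>l j\<close>, so the factor
      from integrating by parts depends on the facet and the depth alone.\<close>
    have "pairing (\<mu> j) (s + cvec a) - of_nat (Suc m) * of_int (\<nu> j) = facet_form j s + of_int (int (l j))"
      unfolding lj by (simp add: facet_form_def pairing_add_cvec algebra_simps)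
    then show ?thesis
      using integration_by_parts[OF region_shift[OF s l], of "\<mu> j" "\<nu> j" \<beta>]
      by (simp add: G_def cvec_add add.assoc del: of_nat_Suc)
  qed
  ultimately show ?thesis by blast
qed

text \<open>The multiplier is common to all terms, so the statement passes through sums and entire
  coefficients. A term already deeper than \<open>l j\<close> is just multiplied by the entire
  factor.\<close>

lemma depth_regular_step:
  assumes "depth_regular l F" and j: "j \<in> {1..N}"
  shows "\<exists>G. depth_regular (l(j := Suc (l j))) G \<and> (\<forall>s\<in>region l. G s = (facet_form j s + of_nat (l j)) * F s)"
  using assms(1)
proof induction
  case (basic a m \<beta>)
  show ?case
  proof (cases "int (l j) = int (npair (\<mu> j) a) - int m * \<nu> j")
    case True
    then show ?thesis by (intro depth_regular_step_term j basic)
  next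
    case False
    have "depth_regular (l(j := Suc (l j))) (\<lambda>s. (facet_form j s + of_nat (l j)) * J \<beta> m (s + cvec a))"
    proof (intro depth_regular.mult holomorphic_Cn_intros depth_regular.basic)
      fix k assume "k \<in> {1..N}"
      then show "int ((l(j := Suc (l j))) k) \<le> int (npair (\<mu> k) a) - int m * \<nu> k"
        using basic[of k] False by auto
    qed
    then show ?thesis by blast
  qed
next
  case zero
  show ?case by (intro exI[of _ "\<lambda>_. 0"]) (simp add: depth_regular.zero)
next
  case (add F1 F2)
  then obtain G1 G2 where G: "depth_regular (l(j := Suc (l j))) G1" "depth_regular (l(j := Suc (l j))) G2"
    and eq: "\<forall>s\<in>region l. G1 s = (facet_form j s + of_nat (l j)) * F1 s"
    "\<forall>s\<in>region l. G2 s = (facet_form j s + of_nat (l j)) * F2 s" by blast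
  have "\<forall>s\<in>region l. G1 s + G2 s = (facet_form j s + of_nat (l j)) * (F1 s + F2 s)"
    using eq by (simp only: distrib_left) simp
  with depth_regular.add[OF G] show ?case by (intro exI conjI)
next
  case (mult c F)
  then obtain G where G: "depth_regular (l(j := Suc (l j))) G"
    and eq: "\<forall>s\<in>region l. G s = (facet_form j s + of_nat (l j)) * F s" by blast
  have "\<forall>s\<in>region l. c s * G s = (facet_form j s + of_nat (l j)) * (c s * F s)"
    using eq by (simp add: mult.left_commute)
  with depth_regular.mult[OF mult(1) G] show ?case by (intro exI conjI)
qed

text \<open>Crossing one facet leaves the depths across the others intact, so the facets of
  \<open>X\<close> can be treated in turn. Intermediate regions only grow, hence all identities hold
  on the initial one.\<close>

lemma depth_regular_step_subset:
  assumes F: "depth_regular (\<lambda>_. L) F" and "X \<subseteq> {1..N}"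
  shows "\<exists>G. depth_regular (\<lambda>k. if k \<in> X then Suc L else L) G \<and>
    (\<forall>s\<in>region (\<lambda>_. L). G s = (\<Prod>k\<in>X. facet_form k s + of_nat L) * F s)"
proof -
  have "finite X" using assms(2) by (rule finite_subset) simp
  then show ?thesis
    using assms(2)
  proof (induction X rule: finite_induct)
    case empty
    show ?case using F by (intro exI[of _ F]) simp
  next
    case (insert j X)
    let ?l = "\<lambda>k. if k \<in> X then Suc L else L"
    obtain G where G: "depth_regular ?l G" "\<And>s. s \<in> region (\<lambda>_. L) \<Longrightarrow> G s = (\<Prod>k\<in>X. facet_form k s + of_nat L) * F s"
      using insert by auto
    have "j \<in> {1..N}" using insert by simp
    from depth_regular_step[OF G(1) this] obtain G' where G': "depth_regular (?l(j := Suc (?l j))) G'"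
      "\<And>s. s \<in> region ?l \<Longrightarrow> G' s = (facet_form j s + of_nat (?l j)) * G s" by blast
    have "?l(j := Suc (?l j)) = (\<lambda>k. if k \<in> insert j X then Suc L else L)"
      using insert(2) by auto
    moreover have "s \<in> region ?l" if "s \<in> region (\<lambda>_. L)" for s
      using that by (fastforce simp: region_def)
    ultimately show ?case
      using G G' insert(1,2) by (intro exI[of _ G']) (auto simp: mult.assoc)
  qed
qed

text \<open>A dependent choice of successive stages; the clause for \<open>L = 0\<close> in
  \<open>?P\<close> pins the chain to the original integral.\<close>

lemma continuation_chain:
  "\<exists>F. F 0 = J 0 0 \<and> (\<forall>L. depth_regular (\<lambda>_. L) (F L) \<and>
    (\<forall>s\<in>region (\<lambda>_. L). F (Suc L) s = (\<Prod>k\<in>{1..N}. facet_form k s + of_nat L) * F L s))"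
proof -
  let ?P = "\<lambda>L F. depth_regular (\<lambda>_. L) F \<and> (L = 0 \<longrightarrow> F = J 0 0)"
  let ?Q = "\<lambda>L F G. \<forall>s\<in>region (\<lambda>_. L). G s = (\<Prod>k\<in>{1..N}. facet_form k s + of_nat L) * F s"
  have base: "?P 0 (J 0 0)"
    using depth_regular.basic[of "\<lambda>_. 0" 0 0 0] by simp
  have step: "\<exists>G. ?P (Suc L) G \<and> ?Q L F G" if "?P L F" for L F
  proof -
    from that have "depth_regular (\<lambda>_. L) F" by blast
    from depth_regular_step_subset[OF this subset_refl]
    obtain G where "depth_regular (\<lambda>k. if k \<in> {1..N} then Suc L else L) G" "?Q L F G" by blast
    moreover from this(1) have "depth_regular (\<lambda>_. Suc L) G" by (rule depth_regular_antimono) simp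
    ultimately show ?thesis by blast
  qed
  have "\<exists>F. \<forall>L. ?P L (F L) \<and> ?Q L (F L) (F (Suc L))"
    by (rule dependent_nat_choice[of ?P ?Q]) (use base step in blast)+
  then show ?thesis by blast
qed

text \<open>The equation \<open>z * rGamma (z + 1) = rGamma z\<close> has no exceptional points. The
  factor gained by \<open>F (Suc L)\<close> is thus absorbed exactly when the arguments of
  \<open>rGamma\<close> move up by 1, even where that factor vanishes.\<close>

lemma entire_quotient:
  "\<exists>\<Phi>. entire_Cn \<Phi> \<and> (\<forall>s\<in>conv_region 0. \<Phi> s = J 0 0 s * (\<Prod>k\<in>{1..N}. rGamma (facet_form k s)))"
proof -
  obtain F where F0: "F 0 = J 0 0" and F: "\<And>L. depth_regular (\<lambda>_. L) (F L)"
    and FS: "\<And>L s. s \<in> region (\<lambda>_. L) \<Longrightarrow> F (Suc L) s = (\<Prod>k\<in>{1..N}. facet_form k s + of_nat L) * F L s"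
    using continuation_chain by blast
  define R where "R L = region (\<lambda>_. L)" for L :: nat
  define \<Psi> where "\<Psi> L s = F L s * (\<Prod>k\<in>{1..N}. rGamma (facet_form k s + of_nat L))" for L s
  have R_mono: "R L \<subseteq> R L'" if "L \<le> L'" for L L'
    using that by (fastforce simp: R_def region_def)
  have step: "\<Psi> (Suc L) s = \<Psi> L s" if "s \<in> R L" for L s
  proof -
    have "\<Psi> (Suc L) s = F L s * (\<Prod>k\<in>{1..N}. (facet_form k s + of_nat L) * rGamma (facet_form k s + of_nat L + 1))"
      using FS[of s L] that by (simp add: \<Psi>_def R_def prod.distrib ac_simps)
    then show ?thesis by (simp add: \<Psi>_def rGamma_plus1)
  qed
  have stable: "\<Psi> L' s = \<Psi> L s" if "L \<le> L'" "s \<in> R L" for L L' s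
    using that(1)
  proof (induction L' rule: dec_induct)
    case (step L')
    then show ?case using \<open>s \<in> R L\<close> R_mono[of L L'] \<open>\<And>L s. s \<in> R L \<Longrightarrow> \<Psi> (Suc L) s = \<Psi> L s\<close> by auto
  qed simp
  \<comment> \<open>There are finitely many facets, so one depth exceeds all the real parts in
    absolute value.\<close>
  have cover: "\<exists>L. s \<in> R L" for s
  proof -
    obtain L :: nat where L: "(\<Sum>k\<in>{1..N}. \<bar>Re (facet_form k s)\<bar>) < real L"
      using reals_Archimedean2 by blast
    have "\<bar>Re (facet_form k s)\<bar> < real L" if "k \<in> {1..N}" for k
      using L member_le_sum[OF that, of "\<lambda>k. \<bar>Re (facet_form k s)\<bar>"] by simp
    then have "s \<in> R L" by (fastforce simp: R_def region_def abs_less_iff)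
    then show ?thesis ..
  qed
  \<comment> \<open>Any admissible \<open>L\<close> may be chosen: by \<open>stable\<close> two of
    them give the same value.\<close>
  define \<Phi> where "\<Phi> s = \<Psi> (SOME L. s \<in> R L) s" for s
  have \<Phi>: "\<Phi> s = \<Psi> L s" if "s \<in> R L" for L s
  proof -
    have "s \<in> R (SOME L. s \<in> R L)" using that by (rule someI)
    then show ?thesis
      using stable[of L "SOME L. s \<in> R L" s] stable[of "SOME L. s \<in> R L" L s] that
      by (cases "L \<le> (SOME L. s \<in> R L)") (auto simp: \<Phi>_def)
  qed
  have R_open: "open (R L)" for L
  proof -
    have "R L = (\<Inter>k\<in>{1..N}. {s. - real L < Re (facet_form k s)})"
      by (auto simp: R_def region_def)
    also have "open \<dots>"
      unfolding facet_form_def pairing_def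
      by (intro open_INT ballI open_Collect_less continuous_intros finite_atLeastAtMost)
    finally show ?thesis .
  qed
  have "holomorphic_Cn_at \<Phi> s" for s
  proof -
    obtain L where L: "s \<in> R L" using cover by blast
    have "holomorphic_Cn_at (F L) s" using depth_regular_holomorphic[OF F] L by (simp add: R_def)
    then have "holomorphic_Cn_at (\<Psi> L) s"
      unfolding \<Psi>_def by (intro holomorphic_Cn_intros)
    then show ?thesis
      by (rule holomorphic_Cn_at_transform[OF _ R_open L]) (simp add: \<Phi>)
  qed
  then have "entire_Cn \<Phi>" by (simp add: entire_Cn_def holomorphic_Cn_on_iff)
  moreover have "\<Phi> s = J 0 0 s * (\<Prod>k\<in>{1..N}. rGamma (facet_form k s))" if "s \<in> conv_region 0" for s
  proof -
    have "s \<in> R 0" using that by (simp add: R_def region_def conv_region_def facet_form_def)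
    then show ?thesis by (simp add: \<Phi> \<Psi>_def F0)
  qed
  ultimately show ?thesis by blast
qed

section \<open>Return to the Mellin integral\<close>

lemma mellin_eq_J:
  assumes "\<And>x. x \<in> nonneg_orthant \<Longrightarrow> D 0 x = \<phi> x" and "s \<in> conv_region 0"
  shows "mellin_converges (\<lambda>x. \<phi> x / poly_at p x) s"
    and "mellin (\<lambda>x. \<phi> x / poly_at p x) s = J 0 0 s"
proof -
  define H where "H x = (\<Prod>i\<in>UNIV. complex_of_real (x $ i) powr (s $ i)) * (\<phi> x / poly_at p x)" for x
  have H: "H (exp_vec t) = exp (cdot s t) * g 0 0 t" for t
  proof -
    \<comment> \<open>The base is positive, so the principal logarithm is the real one and no branch
      question arises.\<close>
    have "complex_of_real (exp r) powr z = exp (z * of_real r)" for r z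
      by (simp add: powr_def Ln_of_real del: of_real_exp)
    then have "(\<Prod>i\<in>UNIV. complex_of_real (exp_vec t $ i) powr (s $ i)) = exp (cdot s t)"
      by (simp add: cdot_def exp_sum del: of_real_exp)
    then show ?thesis
      using assms(1)[OF exp_vec_nonneg, of t] by (simp add: H_def g_def P_def)
  qed
  have eq: "mellin_integrand (\<lambda>x. \<phi> x / poly_at p x) s = (\<lambda>x. H x * (\<Prod>i\<in>UNIV. 1 / complex_of_real (x $ i)))"
    by (simp add: fun_eq_iff mellin_integrand_def H_def)
  have meas: "(\<lambda>t. H (exp_vec t)) \<in> borel_measurable borel" by (simp add: H)
  show "mellin_converges (\<lambda>x. \<phi> x / poly_at p x) s"
    using integral_exp_vec(1)[OF meas] integrable_integrand[OF assms(2)]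
    by (simp add: mellin_converges_def eq H)
  show "mellin (\<lambda>x. \<phi> x / poly_at p x) s = J 0 0 s"
    using integral_exp_vec(2)[OF meas] by (simp add: mellin_def eq H J_def)
qed

end

text \<open>This includes the poles, where \<open>Gamma\<close> is 0 by convention and
  \<open>inverse 0 = 0\<close>.\<close>

lemma Gamma_eq_inverse_rGamma: "Gamma z = inverse (rGamma (z :: complex))"
  by (simp add: rGamma_inverse_Gamma)

theorem theorem2p10:
  fixes p :: "'n::finite cpoly"
    and \<phi> :: "real ^ 'n \<Rightarrow> complex"
    and N :: nat
    and \<mu> :: "nat \<Rightarrow> nat ^ 'n"
    and \<nu> :: "nat \<Rightarrow> int"
  assumes "completely_nonvanishing_on p pos_orthant"
    and "\<phi> \<in> schwartz_nonneg_orthant"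
    and "facet_presentation (newton_polyhedron p) N \<mu> \<nu>"
  shows "\<exists>M \<Phi>. meromorphic_Cn M \<and>
    (\<forall>s. Re_vec s \<in> interior (newton_polyhedron p) \<longrightarrow>
       mellin_converges (\<lambda>x. \<phi> x / poly_at p x) s \<and>
       M s = mellin (\<lambda>x. \<phi> x / poly_at p x) s) \<and>
    entire_Cn \<Phi> \<and>
    (\<forall>s. (\<forall>k\<in>{1..N}. pairing (\<mu> k) s - of_int (\<nu> k) \<notin> \<int>\<^sub>\<le>\<^sub>0) \<longrightarrow>
       M s = \<Phi> s * (\<Prod>k\<in>{1..N}. Gamma (pairing (\<mu> k) s - of_int (\<nu> k))))"
proof -
  obtain D where D: "partial_derivs_on nonneg_orthant \<phi> D"
    "\<And>\<alpha> \<beta>. ((\<lambda>x. complex_of_real (monom_at \<alpha> x) * D \<beta> x) \<longlongrightarrow> 0) (inf at_infinity (principal nonneg_orthant))"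
    using assms(2) unfolding schwartz_nonneg_orthant_def by blast
  have polyh: "newton_polyhedron p = (\<Inter>k\<in>{1..N}. {\<sigma>. to_real_vec (\<mu> k) \<bullet> \<sigma> \<ge> real_of_int (\<nu> k)})"
    using assms(3) unfolding facet_presentation_def by blast
  interpret mellin_setup p D N \<mu> \<nu>
    using assms(1) D polyh by unfold_locales (auto simp: partial_derivs_on_def)
  have D0: "D 0 x = \<phi> x" if "x \<in> nonneg_orthant" for x
    using D(1) that by (simp add: partial_derivs_on_def)
  obtain \<Phi> where \<Phi>: "entire_Cn \<Phi>"
    "\<And>s. s \<in> conv_region 0 \<Longrightarrow> \<Phi> s = J 0 0 s * (\<Prod>k\<in>{1..N}. rGamma (facet_form k s))"
    using entire_quotient by blast
  \<comment> \<open>At the poles \<open>Gamma\<close> takes the default value 0; these are zeros of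
    the denominator in the quotient below, where meromorphy puts no condition on
    \<open>M\<close>.\<close>
  define M where "M s = \<Phi> s * (\<Prod>k\<in>{1..N}. Gamma (facet_form k s))" for s
  \<comment> \<open>The gcd of a zero tuple is 0, not 1.\<close>
  have \<mu>_nonzero: "\<exists>i. \<mu> k $ i > 0" if "k \<in> {1..N}" for k
  proof (rule ccontr)
    assume "\<not> ?thesis"
    then have "range (\<lambda>i. \<mu> k $ i) = {0}" by auto
    moreover have "Gcd (range (\<lambda>i. \<mu> k $ i)) = 1"
      using assms(3) that by (simp add: facet_presentation_def)
    ultimately show False by simp
  qed
  have "meromorphic_Cn M"
    unfolding meromorphic_Cn_def
  proof (rule allI, rule exI[of _ UNIV], rule exI[of _ \<Phi>],
      rule exI[of _ "\<lambda>s. \<Prod>k\<in>{1..N}. rGamma (facet_form k s)"], intro conjI ballI impI)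
    let ?h = "\<lambda>s. \<Prod>k\<in>{1..N}. rGamma (facet_form k s)"
    show "holomorphic_Cn_on \<Phi> UNIV" using \<Phi>(1) by (simp add: entire_Cn_def)
    show "holomorphic_Cn_on ?h UNIV"
      unfolding holomorphic_Cn_on_iff by (intro ballI holomorphic_Cn_intros)
    show "M w = \<Phi> w / ?h w" for w
      by (simp only: M_def Gamma_eq_inverse_rGamma divide_inverse prod_inversef[symmetric] o_def)
    show "\<exists>w\<in>UNIV. ?h w \<noteq> 0"
    proof -
      \<comment> \<open>At the point with all coordinates \<open>r\<close> each linear form is at
        least \<open>r\<close>, because \<open>\<mu> k\<close> has a positive integer entry, and
        \<open>r\<close> exceeds every \<open>\<nu> k\<close>. So all arguments of
        \<open>rGamma\<close> have positive real part.\<close>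
      define r where "r = 1 + (\<Sum>k\<in>{1..N}. \<bar>real_of_int (\<nu> k)\<bar>)"
      define w :: "complex ^ 'n" where "w = (\<chi> i. of_real r)"
      have "r \<ge> 1" by (simp add: r_def sum_nonneg)
      have "rGamma (facet_form k w) \<noteq> 0" if k: "k \<in> {1..N}" for k
      proof -
        obtain i where i: "\<mu> k $ i > 0" using \<mu>_nonzero[OF k] by blast
        have "real_of_int (\<nu> k) < r"
          using member_le_sum[OF k, of "\<lambda>k. \<bar>real_of_int (\<nu> k)\<bar>"] by (simp add: r_def)
        also have "r \<le> real (\<mu> k $ i) * r" using i \<open>r \<ge> 1\<close> by simp
        also have "\<dots> \<le> (\<Sum>i\<in>UNIV. real (\<mu> k $ i) * r)"
          using \<open>r \<ge> 1\<close> by (intro member_le_sum) auto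
        also have "\<dots> = Re (pairing (\<mu> k) w)" by (simp add: pairing_def w_def)
        finally have "Re (facet_form k w) > 0" by (simp add: facet_form_def)
        then show ?thesis by (auto simp: rGamma_eq_zero_iff elim!: nonpos_Ints_cases)
      qed
      then show ?thesis by (intro bexI[of _ w]) auto
    qed
  qed (auto)
  moreover have "mellin_converges (\<lambda>x. \<phi> x / poly_at p x) s \<and> M s = mellin (\<lambda>x. \<phi> x / poly_at p x) s"
    if s: "Re_vec s \<in> interior (newton_polyhedron p)" for s
  proof -
    have gt: "real_of_int (\<nu> k) < Re (pairing (\<mu> k) s)" if k: "k \<in> {1..N}" for k
    proof -
      \<comment> \<open>For a non-zero normal the interior of the half-space is the open half-space,
        which supplies the strict inequality.\<close>
      have "to_real_vec (\<mu> k) \<noteq> 0" using \<mu>_nonzero[OF k] by (auto simp: vec_eq_iff)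
      moreover have "Re_vec s \<in> interior {\<sigma>. to_real_vec (\<mu> k) \<bullet> \<sigma> \<ge> real_of_int (\<nu> k)}"
        using k by (intro subsetD[OF interior_mono s]) (unfold polyh, rule INT_lower)
      ultimately show ?thesis by (simp add: interior_halfspace_ge Re_pairing)
    qed
    then have conv: "s \<in> conv_region 0" by (simp add: conv_region_def)
    \<comment> \<open>In the domain of convergence no argument meets a pole, so the Gamma factors of
      \<open>M\<close> cancel those built into \<Phi>.\<close>
    have "rGamma (facet_form k s) * Gamma (facet_form k s) = 1" if "k \<in> {1..N}" for k
    proof -
      have "Re (facet_form k s) > 0" using gt[OF that] by (simp add: facet_form_def)
      then have "rGamma (facet_form k s) \<noteq> 0" by (auto simp: rGamma_eq_zero_iff elim!: nonpos_Ints_cases)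
      then show ?thesis by (simp add: Gamma_eq_inverse_rGamma)
    qed
    then have "M s = J 0 0 s"
      by (simp add: M_def \<Phi>(2)[OF conv] mult.assoc flip: prod.distrib)
    then show ?thesis using mellin_eq_J[OF D0 conv] by simp
  qed
  moreover have "M s = \<Phi> s * (\<Prod>k\<in>{1..N}. Gamma (pairing (\<mu> k) s - of_int (\<nu> k)))" for s
    by (simp add: M_def facet_form_def)
  ultimately show ?thesis using \<Phi>(1) by blast
qed

end
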